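(* Let $a,b$ be real numbers such that $0<b<a<1$, $a+b>1$ and $a^3+b^3=1$, and such that there exists a real number $\lambda>1$ with $a+2b\lambda\le\lambda$. Let $X_{a,b}$ be the Bourgain-Delbaen space with parameters $a,b$. Then every bounded linear operator from $\ell_2$ to $X_{a,b}$ is compact, and every bounded linear operator from $X_{a,b}$ to $\ell_2$ is compact.
   Context: All Banach spaces are over a common scalar field ($\mathbb{R}$ or $\mathbb{C}$), and $\ell_\infty$, $\ell_2$ are the usual sequence spaces indexed by $\mathbb{N}=\{1,2,\dots\}$. Let $e_i$ denote the sequence with $e_i(j)=\delta_{i,j}$. For $d\in\mathbb{N}$ put $E_d=\operatorname{span}\{e_i : 1\le i\le d\}\subseteq\ell_\infty$. For a sequence $x$ write $x_i$ for its $i$-th coordinate. Construction of the Bourgain-Delbaen space $X_{a,b}$. Fix real numbers $a,b$ and $\lambda>1$ with $0<b<a<1$, $a+2b\lambda\le\lambda$ and $a+b>1$ (the number $\lambda$ is not used in the construction itself). One constructs by induction a sequence of positive integers $(d_n)_{n\ge 1}$ and linear maps $i_{m,l}:E_{d_m}\to E_{d_l}$ for $m<l$. For each $m$, let $\pi_m$ denote the natural projection of a sequence onto its first $d_m$ coordinates (all other coordinates being replaced by $0$). Start with $d_1=1$. Suppose $d_1,\dots,d_n$ and the maps $i_{m,l}$ for $1\le m<l\le n$ are known and satisfy $\pi_m\circ i_{m,n}=\mathrm{id}_{E_{d_m}}$ for $m<n$ and $i_{l,n}\circ i_{m,l}=i_{m,n}$ for $m<l<n$. For every tuple $\gamma=(m,i,j,\varepsilon',\varepsilon'')$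 with $1\le m<n$, $1\le i\le d_m$, $1\le j\le d_n$ and $\varepsilon',\varepsilon''\in\{1,-1\}$, define a linear functional $c_\gamma^*$ on $E_{d_n}$ by $$c_\gamma^*(x)=\varepsilon' a\,x_i+\varepsilon'' b\,\bigl(x-i_{m,n}(\pi_m(x))\bigr)_j .$$ Let $\mathcal{F}_n$ be the (finite) set of all such functionals $c_\gamma^*$ (so $\mathcal{F}_1=\emptyset$), and put $d_{n+1}=d_n+\operatorname{card}\mathcal{F}_n$. Fixing an enumeration of $\mathcal{F}_n$, define $$i_{n,n+1}:E_{d_n}\to E_{d_{n+1}},\qquad i_{n,n+1}(x)=\bigl(x_1,\dots,x_{d_n},(f(x))_{f\in\mathcal{F}_n},0,0,\dots\bigr),$$ and set $i_{m,n+1}=i_{n,n+1}\circ i_{m,n}$ for $m<n$. For each $n$ define $i_n:E_{d_n}\to\ell_\infty$ as the coordinatewise limit $i_n(x)=\lim_{m\to\infty} i_{n,m}(x)$, where $i_{n,m}=i_{m-1,m}\circ\cdots\circ i_{n,n+1}$. (It is a known result of Bourgain and Delbaen that under the conditions $\lambda>1$, $0<b<a<1$, $a+2b\lambda\le\lambda$ and $a+b>1$ one has $\|i_n\|\le\lambda$ for all $n$, so $i_n$ indeed takes values in $\ell_\infty$.) Put $F_n=i_n(E_{d_n})\subseteq\ell_\infty$. The space $X_{a,b}$ is the closure in $\ell_\infty$ of $\bigcup_{n\in\mathbb{N}}F_n$, with the supremum norm. *)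

theory Defs
  imports "HOL-Analysis.Analysis"
begin

text \<open>
  Everything is parametrised by the scalar type \<open>'k\<close>, which is meant to be \<open>real\<close> or \<open>complex\<close>.
  Coordinates of sequences and the stages of the construction are numbered from 0 instead of 1.
\<close>

section \<open>The sequence spaces\<close>

text \<open>
  Since \<open>nat\<close> is discrete, a bounded continuous function on \<open>nat\<close> is just a bounded sequence; the
  library norm on this type is the supremum norm.
\<close>

type_synonym 'k linf = "nat \<Rightarrow>\<^sub>C 'k"

definition scale_linf :: "'k::real_normed_field \<Rightarrow> 'k linf \<Rightarrow> 'k linf" where
  "scale_linf c x = Bcontfun (\<lambda>n. c * apply_bcontfun x n)"

lemma scale_linf_apply: "apply_bcontfun (scale_linf c x) n = c * apply_bcontfun x n"
proof -
  have "norm (c * apply_bcontfun x m) \<le> norm c * norm x" for m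
    by (simp add: norm_mult mult_left_mono norm_bounded)
  then have "(\<lambda>m. c * apply_bcontfun x m) \<in> bcontfun"
    by (intro bcontfun_normI) (auto intro: continuous_on_discrete)
  then show ?thesis
    by (simp add: scale_linf_def Bcontfun_inverse)
qed

lemma l2_minkowski:
  fixes x y :: "nat \<Rightarrow> 'k::real_normed_vector"
  assumes x: "summable (\<lambda>n. (norm (x n))\<^sup>2)" and y: "summable (\<lambda>n. (norm (y n))\<^sup>2)"
  shows "summable (\<lambda>n. (norm (x n + y n))\<^sup>2)"
    and "sqrt (\<Sum>n. (norm (x n + y n))\<^sup>2)
           \<le> sqrt (\<Sum>n. (norm (x n))\<^sup>2) + sqrt (\<Sum>n. (norm (y n))\<^sup>2)"
proof -
  let ?S = "sqrt (\<Sum>n. (norm (x n))\<^sup>2) + sqrt (\<Sum>n. (norm (y n))\<^sup>2)"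
  have part: "(\<Sum>n<N. (norm (x n + y n))\<^sup>2) \<le> ?S\<^sup>2" for N
  proof -
    have "sqrt (\<Sum>n<N. (norm (x n + y n))\<^sup>2) \<le> L2_set (\<lambda>n. norm (x n) + norm (y n)) {..<N}"
      unfolding L2_set_def by (intro real_sqrt_le_mono sum_mono power_mono norm_triangle_ineq) auto
    also have "\<dots> \<le> L2_set (\<lambda>n. norm (x n)) {..<N} + L2_set (\<lambda>n. norm (y n)) {..<N}"
      by (rule L2_set_triangle_ineq)
    also have "\<dots> \<le> ?S"
      unfolding L2_set_def
      by (intro add_mono real_sqrt_le_mono sum_le_suminf x y) auto
    finally show ?thesis
      by (rule sqrt_le_D)
  qed
  show s: "summable (\<lambda>n. (norm (x n + y n))\<^sup>2)"
    by (rule summableI_nonneg_bounded[OF _ part]) auto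
  have "(\<Sum>n. (norm (x n + y n))\<^sup>2) \<le> ?S\<^sup>2"
    by (rule suminf_le_const[OF s part])
  then show "sqrt (\<Sum>n. (norm (x n + y n))\<^sup>2) \<le> ?S"
    by (intro real_le_lsqrt) (auto intro!: add_nonneg_nonneg suminf_nonneg x y)
qed

typedef (overloaded) ('k::real_normed_vector) ell2 =
  "{x :: nat \<Rightarrow> 'k. summable (\<lambda>n. (norm (x n))\<^sup>2)}"
  morphisms ell2_nth Abs_ell2
  by (rule exI[of _ "\<lambda>_. 0"]) simp

setup_lifting type_definition_ell2

lift_definition scale_ell2 :: "'k::real_normed_field \<Rightarrow> 'k ell2 \<Rightarrow> 'k ell2"
  is "\<lambda>c x n. c * x n"
  by (simp add: norm_mult power_mult_distrib summable_mult)

instantiation ell2 :: (real_normed_vector) real_normed_vector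
begin

lift_definition zero_ell2 :: "'a ell2" is "\<lambda>_. 0"
  by simp

lift_definition plus_ell2 :: "'a ell2 \<Rightarrow> 'a ell2 \<Rightarrow> 'a ell2" is "\<lambda>x y n. x n + y n"
  by (rule l2_minkowski)

lift_definition uminus_ell2 :: "'a ell2 \<Rightarrow> 'a ell2" is "\<lambda>x n. - x n"
  by simp

lift_definition minus_ell2 :: "'a ell2 \<Rightarrow> 'a ell2 \<Rightarrow> 'a ell2" is "\<lambda>x y n. x n - y n"
  subgoal for x y
    using l2_minkowski(1)[of x "\<lambda>n. - y n"] by simp
  done

lift_definition scaleR_ell2 :: "real \<Rightarrow> 'a ell2 \<Rightarrow> 'a ell2" is "\<lambda>r x n. r *\<^sub>R x n"
  by (simp add: power_mult_distrib summable_mult)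

lift_definition norm_ell2 :: "'a ell2 \<Rightarrow> real" is "\<lambda>x. sqrt (\<Sum>n. (norm (x n))\<^sup>2)" .

definition sgn_ell2 :: "'a ell2 \<Rightarrow> 'a ell2" where
  "sgn_ell2 x = inverse (norm x) *\<^sub>R x"

definition dist_ell2 :: "'a ell2 \<Rightarrow> 'a ell2 \<Rightarrow> real" where
  "dist_ell2 x y = norm (x - y)"

definition uniformity_ell2 :: "('a ell2 \<times> 'a ell2) filter" where
  "uniformity_ell2 = (INF e\<in>{0<..}. principal {(x, y). dist x y < e})"

definition open_ell2 :: "'a ell2 set \<Rightarrow> bool" where
  "open_ell2 U = (\<forall>x\<in>U. \<forall>\<^sub>F (x', y) in uniformity. x' = x \<longrightarrow> y \<in> U)"

instance
proof
  fix x y z :: "'a ell2" and r s :: real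
  show "x + y + z = x + (y + z)" "x + y = y + x" "0 + x = x" "- x + x = 0" "x - y = x + - y"
    by (transfer; simp add: fun_eq_iff algebra_simps)+
  show "r *\<^sub>R (x + y) = r *\<^sub>R x + r *\<^sub>R y" "(r + s) *\<^sub>R x = r *\<^sub>R x + s *\<^sub>R x"
    "r *\<^sub>R s *\<^sub>R x = (r * s) *\<^sub>R x" "1 *\<^sub>R x = x"
    by (transfer; simp add: fun_eq_iff algebra_simps)+
  show "(norm x = 0) = (x = 0)"
    by transfer (simp add: suminf_eq_zero_iff fun_eq_iff)
  show "norm (x + y) \<le> norm x + norm y"
    by transfer (rule l2_minkowski)
  show "norm (r *\<^sub>R x) = \<bar>r\<bar> * norm x"
    by transfer (simp add: power_mult_distrib suminf_mult real_sqrt_mult)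
qed (simp_all add: sgn_ell2_def dist_ell2_def uniformity_ell2_def open_ell2_def)

end

section \<open>Operators\<close>

text \<open>
  Operators between linear subspaces \<open>V\<close> and \<open>W\<close>. The scalar multiplications are arguments, because
  the library only provides the real one. Values of \<open>T\<close> outside \<open>V\<close> are irrelevant.
\<close>

definition bounded_operator ::
  "('k \<Rightarrow> 'v \<Rightarrow> 'v) \<Rightarrow> ('k \<Rightarrow> 'w \<Rightarrow> 'w) \<Rightarrow> 'v::real_normed_vector set \<Rightarrow> 'w::real_normed_vector set
    \<Rightarrow> ('v \<Rightarrow> 'w) \<Rightarrow> bool" where
  "bounded_operator sV sW V W T \<longleftrightarrow>
     T ` V \<subseteq> W \<and>
     (\<forall>x\<in>V. \<forall>y\<in>V. T (x + y) = T x + T y) \<and>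
     (\<forall>c. \<forall>x\<in>V. T (sV c x) = sW c (T x)) \<and>
     (\<exists>C. \<forall>x\<in>V. norm (T x) \<le> C * norm x)"

text \<open>The closure of the image of the unit ball of \<open>V\<close> is taken relative to \<open>W\<close>.\<close>

definition compact_operator ::
  "'v::real_normed_vector set \<Rightarrow> 'w::real_normed_vector set \<Rightarrow> ('v \<Rightarrow> 'w) \<Rightarrow> bool" where
  "compact_operator V W T \<longleftrightarrow> compact (W \<inter> closure (T ` {x \<in> V. norm x \<le> 1}))"

section \<open>The Bourgain-Delbaen construction\<close>

definition coord_space :: "nat \<Rightarrow> (nat \<Rightarrow> 'k::zero) set" where
  "coord_space d = {x. \<forall>k\<ge>d. x k = 0}"

lemma coord_space_eq_span:
  "coord_space d = range (\<lambda>c :: nat \<Rightarrow> 'k::ring_1. \<lambda>k. \<Sum>i<d. c i * (if k = i then 1 else 0))"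
proof -
  have *: "(\<Sum>i<d. c i * (if k = i then 1 else 0)) = (if k < d then c k else 0)"
    for c :: "nat \<Rightarrow> 'k" and k
  proof -
    have "(\<Sum>i<d. c i * (if k = i then 1 else 0)) = (\<Sum>i<d. if k = i then c i else 0)"
      by (intro sum.cong) auto
    then show ?thesis by (simp add: sum.delta)
  qed
  show ?thesis
  proof (intro equalityI subsetI)
    fix x :: "nat \<Rightarrow> 'k" assume "x \<in> coord_space d"
    then show "x \<in> range (\<lambda>c k. \<Sum>i<d. c i * (if k = i then 1 else 0))"
      unfolding * by (intro range_eqI[of _ _ x]) (auto simp: coord_space_def)
  qed (auto simp: * coord_space_def)
qed

definition coord_proj :: "nat \<Rightarrow> (nat \<Rightarrow> 'k::zero) \<Rightarrow> nat \<Rightarrow> 'k" where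
  "coord_proj d x = (\<lambda>k. if k < d then x k else 0)"

text \<open>
  The functionals are restricted to \<open>coord_space (d n)\<close>, so that two tuples \<open>(m, i, j, e', e'')\<close>
  inducing the same functional on that space contribute only one element.
\<close>

definition bd_functionals ::
  "real \<Rightarrow> real \<Rightarrow> (nat \<Rightarrow> nat) \<Rightarrow> (nat \<Rightarrow> nat \<Rightarrow> (nat \<Rightarrow> 'k) \<Rightarrow> nat \<Rightarrow> 'k) \<Rightarrow> nat
    \<Rightarrow> ((nat \<Rightarrow> 'k::real_normed_field) \<Rightarrow> 'k) set" where
  "bd_functionals a b d inc n =
     {(\<lambda>x\<in>coord_space (d n).
         e' * of_real a * x i + e'' * of_real b * (x j - inc m n (coord_proj (d m) x) j))
       | m i j e' e''. m < n \<and> i < d m \<and> j < d n \<and> e' \<in> {1, -1} \<and> e'' \<in> {1, -1}}"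

text \<open>
  \<open>inc m l\<close>, for \<open>m < l\<close>, is the map \<open>i\<^bsub>m,l\<^esub>\<close>; only its values on \<open>coord_space (d m)\<close> matter.
  The enumerations \<open>enum\<close> of the sets of functionals may be chosen freely at each stage.
\<close>

definition bd_construction ::
  "real \<Rightarrow> real \<Rightarrow> (nat \<Rightarrow> nat) \<Rightarrow> (nat \<Rightarrow> nat \<Rightarrow> (nat \<Rightarrow> 'k) \<Rightarrow> nat \<Rightarrow> 'k::real_normed_field)
    \<Rightarrow> bool" where
  "bd_construction a b d inc \<longleftrightarrow>
     d 0 = 1 \<and>
     (\<forall>n. d (Suc n) = d n + card (bd_functionals a b d inc n)) \<and>
     (\<forall>n. \<exists>enum. bij_betw enum {d n..<d (Suc n)} (bd_functionals a b d inc n) \<and>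
        (\<forall>x\<in>coord_space (d n). inc n (Suc n) x =
           (\<lambda>k. if k < d n then x k else if k < d (Suc n) then enum k x else 0))) \<and>
     (\<forall>m n. m < n \<longrightarrow> (\<forall>x\<in>coord_space (d m). inc m (Suc n) x = inc n (Suc n) (inc m n x)))"

definition bd_embedding ::
  "(nat \<Rightarrow> nat \<Rightarrow> (nat \<Rightarrow> 'k) \<Rightarrow> nat \<Rightarrow> 'k::real_normed_field) \<Rightarrow> nat \<Rightarrow> (nat \<Rightarrow> 'k) \<Rightarrow> nat \<Rightarrow> 'k"
  where "bd_embedding inc n x = (\<lambda>k. lim (\<lambda>m. inc n m x k))"

text \<open>
  In the parameter range \<open>1 < lam\<close>, \<open>0 < b < a < 1\<close>, \<open>a + 2 b lam \<le> lam\<close>, \<open>a + b > 1\<close> all sequences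
  \<open>bd_embedding inc n x\<close> with \<open>x \<in> coord_space (d n)\<close> are bounded (Bourgain and Delbaen), so none of
  them is lost when passing to the type of bounded sequences.
\<close>

definition bd_subspace ::
  "(nat \<Rightarrow> nat) \<Rightarrow> (nat \<Rightarrow> nat \<Rightarrow> (nat \<Rightarrow> 'k) \<Rightarrow> nat \<Rightarrow> 'k::real_normed_field) \<Rightarrow> nat \<Rightarrow> 'k linf set"
  where "bd_subspace d inc n = {f. apply_bcontfun f \<in> bd_embedding inc n ` coord_space (d n)}"

definition bd_space ::
  "(nat \<Rightarrow> nat) \<Rightarrow> (nat \<Rightarrow> nat \<Rightarrow> (nat \<Rightarrow> 'k) \<Rightarrow> nat \<Rightarrow> 'k::real_normed_field) \<Rightarrow> 'k linf set"
  where "bd_space d inc = closure (\<Union>n. bd_subspace d inc n)"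

subsection \<open>The construction can be carried out\<close>

lemma finite_bd_functionals: "finite (bd_functionals a b d inc n)"
proof -
  let ?c = "\<lambda>m i j e' e''. \<lambda>x\<in>coord_space (d n).
         e' * of_real a * x i + e'' * of_real b * (x j - inc m n (coord_proj (d m) x) j)"
  have "bd_functionals a b d inc n
      \<subseteq> (\<Union>m<n. \<Union>i<d m. \<Union>j<d n. \<Union>e'\<in>{1, -1}. (\<lambda>e''. ?c m i j e' e'') ` {1, -1})"
  proof
    fix f assume "f \<in> bd_functionals a b d inc n"
    then obtain m i j e' e'' where "f = ?c m i j e' e''" "m < n" "i < d m" "j < d n"
        "e' \<in> {1, -1}" "e'' \<in> {1, -1}"
      unfolding bd_functionals_def mem_Collect_eq by (elim exE conjE)
    then show "f \<in> (\<Union>m<n. \<Union>i<d m. \<Union>j<d n. \<Union>e'\<in>{1, -1}. (\<lambda>e''. ?c m i j e' e'') ` {1, -1})"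
      by (intro UN_I[of m] UN_I[of i] UN_I[of j] UN_I[of e'] image_eqI[of _ _ e''])
         (simp_all only: lessThan_iff)
  qed
  then show ?thesis
    by (rule finite_subset) (intro finite_UN_I finite_imageI; simp)
qed

lemma bd_functionals_cong:
  assumes "\<And>m. m \<le> n \<Longrightarrow> d m = d' m" and "\<And>m. m < n \<Longrightarrow> inc m n = inc' m n"
  shows "bd_functionals a b d inc n = bd_functionals a b d' inc' n"
proof -
  have sub: "bd_functionals a b D J n \<subseteq> bd_functionals a b D' J' n"
    if "\<And>m. m \<le> n \<Longrightarrow> D m = D' m" and "\<And>m. m < n \<Longrightarrow> J m n = J' m n"
    for D D' and J J' :: "nat \<Rightarrow> nat \<Rightarrow> (nat \<Rightarrow> 'a) \<Rightarrow> nat \<Rightarrow> 'a"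
  proof
    fix f assume "f \<in> bd_functionals a b D J n"
    then obtain m i j e' e'' where f: "f = (\<lambda>x\<in>coord_space (D n).
         e' * of_real a * x i + e'' * of_real b * (x j - J m n (coord_proj (D m) x) j))"
      and m: "m < n" and r: "i < D m" "j < D n" "e' \<in> {1, -1}" "e'' \<in> {1, -1}"
      unfolding bd_functionals_def mem_Collect_eq by (elim exE conjE)
    have eq: "D n = D' n" "D m = D' m" "J m n = J' m n"
      using that m by auto
    show "f \<in> bd_functionals a b D' J' n"
      unfolding bd_functionals_def mem_Collect_eq
      using f m r unfolding eq by (intro exI conjI)
  qed
  show ?thesis
    by (intro equalityI sub) (simp_all add: assms)
qed

lemma bd_construction_exists:
  "\<exists>d (inc :: nat \<Rightarrow> nat \<Rightarrow> (nat \<Rightarrow> 'k) \<Rightarrow> nat \<Rightarrow> 'k::real_normed_field). bd_construction a b d inc"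
proof -
  define fs where "fs n D I = bd_functionals a b D (\<lambda>m _. I m) n"
    for n D and I :: "nat \<Rightarrow> (nat \<Rightarrow> 'k) \<Rightarrow> nat \<Rightarrow> 'k"
  define en where "en n D I = (SOME e. bij_betw e {D n..<D n + card (fs n D I)} (fs n D I))"
    for n D and I :: "nat \<Rightarrow> (nat \<Rightarrow> 'k) \<Rightarrow> nat \<Rightarrow> 'k"
  define step where "step n D I x = (\<lambda>k. if k < D n then x k else
        if k < D n + card (fs n D I) then en n D I k x else 0)"
    for n D I and x :: "nat \<Rightarrow> 'k"
  define H where "H = rec_nat (\<lambda>_. 1, \<lambda>_. id) (\<lambda>n (D, I).
      (D(Suc n := D n + card (fs n D I)),
       \<lambda>m. if m < n then step n D I \<circ> I m else step n D I))"
  define d where "d n = fst (H n) n" for n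
  define inc where "inc m n = snd (H n) m" for m n
  have H0: "H 0 = (\<lambda>_. 1, \<lambda>_. id)"
    by (simp add: H_def)
  have fstS: "fst (H (Suc n)) =
      (fst (H n))(Suc n := fst (H n) n + card (fs n (fst (H n)) (snd (H n))))" for n
    by (simp add: H_def case_prod_beta cong: if_cong)
  have sndS: "snd (H (Suc n)) = (\<lambda>m. if m < n then step n (fst (H n)) (snd (H n)) \<circ> snd (H n) m
      else step n (fst (H n)) (snd (H n)))" for n
    by (simp add: H_def case_prod_beta cong: if_cong)
  have hist: "fst (H n) m = d m" if "m \<le> n" for m n
    using that
  proof (induction n)
    case (Suc n)
    then show ?case
      by (cases "m = Suc n") (auto simp: d_def fstS)
  qed (simp add: d_def)
  have F: "fs n (fst (H n)) (snd (H n)) = bd_functionals a b d inc n" for n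
    unfolding fs_def by (rule bd_functionals_cong) (auto simp: hist inc_def)
  have dS: "d (Suc n) = d n + card (bd_functionals a b d inc n)" for n
    using fstS[of n] by (simp add: d_def F)
  have incS: "inc n (Suc n) = step n (fst (H n)) (snd (H n))" for n
    by (simp add: inc_def sndS)
  have bij: "bij_betw (en n (fst (H n)) (snd (H n))) {d n..<d (Suc n)} (bd_functionals a b d inc n)"
    for n
  proof -
    have "\<exists>e. bij_betw e {d n..<d (Suc n)} (bd_functionals a b d inc n)"
      by (rule finite_same_card_bij) (auto simp: finite_bd_functionals dS)
    then show ?thesis
      unfolding en_def F hist[OF order_refl] dS by (rule someI_ex)
  qed
  have "bd_construction a b d inc"
    unfolding bd_construction_def
  proof (intro conjI allI impI ballI)
    show "d 0 = 1"
      by (simp add: d_def H0)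
  next
    fix n show "d (Suc n) = d n + card (bd_functionals a b d inc n)"
      by (rule dS)
  next
    fix n show "\<exists>enum. bij_betw enum {d n..<d (Suc n)} (bd_functionals a b d inc n) \<and>
        (\<forall>x\<in>coord_space (d n). inc n (Suc n) x =
           (\<lambda>k. if k < d n then x k else if k < d (Suc n) then enum k x else 0))"
      using bij[of n]
      by (intro exI[of _ "en n (fst (H n)) (snd (H n))"]) (simp add: incS step_def F hist dS cong: if_cong)
  next
    fix m n :: nat and x :: "nat \<Rightarrow> 'k" assume "m < n"
    then show "inc m (Suc n) x = inc n (Suc n) (inc m n x)"
      by (simp add: inc_def sndS)
  qed
  then show ?thesis
    by blast
qed

end

theory Submission
  imports Defs
begin

text \<open>
  Write \<open>F\<^sub>n\<close> for the subspaces of the construction, \<open>P\<^sub>n\<close> for the projection of the union of these onto \<open>F\<^sub>n\<close>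
  that keeps the first \<open>d\<^sub>n\<close> coordinates, and call \<open>x\<close> a block if \<open>x \<in> F\<^sub>q\<close> and \<open>P\<^sub>p x = 0\<close> for some \<open>p < q\<close>. Each
  coordinate created after level \<open>n\<close> has the form \<open>x g = \<plusminus>a x\<^sub>i \<plusminus> b (x - P\<^sub>m x)\<^sub>j\<close> on \<open>F\<^sub>n\<close>. Both halves of
  the theorem read this formula against a sequence of successive blocks. With
  \<open>a\<^sup>3 + b\<^sup>3 = 1\<close>, sums of blocks in the space behave somewhat like those of \<open>l\<^sub>p\<close> for the exponent \<open>3/2\<close>, which
  is smaller than 2.

  Operators from \<open>l\<^sub>2\<close>. If \<open>T\<close> is not compact, there are normalised finite vectors arbitrarily far out
  in \<open>l\<^sub>2\<close> whose images are close to blocks and have norm at least \<open>\<delta>\<close>. Given two such vectors \<open>u\<^sub>1\<close>,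
  \<open>u\<^sub>2\<close> with images near successive blocks \<open>x\<^sub>1\<close>, \<open>x\<^sub>2\<close>, some coordinate has on \<open>a\<^sup>2 x\<^sub>1 + b\<^sup>2 x\<^sub>2\<close> the value
  \<open>a\<^sup>3 x\<^sub>1 i + b\<^sup>3 x\<^sub>2 j\<close>, which is again at least \<open>\<delta>\<close>; but the squared norm of \<open>a\<^sup>2 u\<^sub>1 + b\<^sup>2 u\<^sub>2\<close> has
  dropped by the factor \<open>a\<^sup>4 + b\<^sup>4 < 1\<close>. Iterating along a binary tree (\<open>witness_step\<close>) contradicts
  boundedness.

  Operators to \<open>l\<^sub>2\<close>. The same formula gives an upper estimate: at every coordinate, the values of
  successive blocks have bounded sum of fourth powers (\<open>block_fourth_powers\<close>). So bounded functionals
  tend to zero on blocks, uniformly on bounded sets (\<open>functional_tail\<close>). If \<open>T\<close> is not compact, it has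
  humps in disjoint ranges of coordinates of \<open>l\<^sub>2\<close>. As \<open>F\<^sub>n\<close> is isomorphic to a finite-dimensional \<open>l\<^sub>\<infinity>\<close>
  space, with constants that do not depend on \<open>n\<close>, the entries of the corresponding blocks can be placed
  side by side at the cost of a constant factor in the norm. Signs prevent cancellation, and the
  vanishing of functionals on blocks prevents later blocks from destroying earlier humps (\<open>gliding_hump\<close>). The image of a
  bounded vector then carries arbitrarily many humps, which is impossible.

  Compactness itself follows from the smallness of \<open>T\<close> composed with the projections of \<open>l\<^sub>2\<close> onto
  tails. Throughout, multiplication by unimodular scalars takes the place of complex conjugation, so that
  real and complex scalars are treated together.
\<close>

section \<open>Square-summable sequences\<close>

lemma ell2_summable [simp]: "summable (\<lambda>n. (norm (ell2_nth x n))\<^sup>2)"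
  using ell2_nth[of x] by simp

lemma norm_ell2_sq: "(norm (x :: 'k::real_normed_vector ell2))\<^sup>2 = (\<Sum>n. (norm (ell2_nth x n))\<^sup>2)"
  by (simp add: norm_ell2.rep_eq suminf_nonneg)

lemmas ell2_nth_simps [simp] = zero_ell2.rep_eq plus_ell2.rep_eq minus_ell2.rep_eq uminus_ell2.rep_eq
  scale_ell2.rep_eq scaleR_ell2.rep_eq

lemma ell2_eqI: "(\<And>n. ell2_nth x n = ell2_nth y n) \<Longrightarrow> x = y"
  by (metis ell2_nth_inject ext)

lemma sum_le_norm_ell2_sq:
  fixes x :: "'k::real_normed_vector ell2"
  assumes "finite A"
  shows "(\<Sum>n\<in>A. (norm (ell2_nth x n))\<^sup>2) \<le> (norm x)\<^sup>2"
  unfolding norm_ell2_sq using assms by (intro sum_le_suminf) auto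

lemma norm_ell2_sq_leI:
  fixes x :: "'k::real_normed_vector ell2"
  assumes "\<And>N. (\<Sum>n<N. (norm (ell2_nth x n))\<^sup>2) \<le> c"
  shows "(norm x)\<^sup>2 \<le> c"
  unfolding norm_ell2_sq by (intro suminf_le_const assms) auto

lemma norm_ell2_nth_le: "norm (ell2_nth x n) \<le> norm x"
  using sum_le_norm_ell2_sq[of "{n}" x] by (simp add: power2_le_iff_abs_le)

lemma norm_scale_ell2: "norm (scale_ell2 c x) = norm c * norm x"
  by transfer (simp add: norm_mult power_mult_distrib suminf_mult real_sqrt_mult)

text \<open>
  An operator into or out of the sequence space is compact as soon as its composition with \<open>tail_ell2 m\<close>
  tends to zero in norm; the compactness proofs only ever estimate such compositions.
\<close>

lift_definition head_ell2 :: "nat \<Rightarrow> 'k::real_normed_vector ell2 \<Rightarrow> 'k ell2"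
  is "\<lambda>m x n. if n < m then x n else 0"
  by (rule summable_finite[of "{..<m}" for m]) auto

definition tail_ell2 :: "nat \<Rightarrow> 'k::real_normed_vector ell2 \<Rightarrow> 'k ell2" where
  "tail_ell2 m x = x - head_ell2 m x"

lemma head_ell2_nth [simp]: "ell2_nth (head_ell2 m x) n = (if n < m then ell2_nth x n else 0)"
  by (simp add: head_ell2.rep_eq)

lemma tail_ell2_nth [simp]: "ell2_nth (tail_ell2 m x) n = (if n < m then 0 else ell2_nth x n)"
  by (simp add: tail_ell2_def)

lemma norm_head_ell2_sq:
  "(norm (head_ell2 m x))\<^sup>2 = (\<Sum>n<m. (norm (ell2_nth x n))\<^sup>2)"
proof -
  have "(norm (head_ell2 m x))\<^sup>2 = (\<Sum>n<m. (norm (ell2_nth (head_ell2 m x) n))\<^sup>2)"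
    unfolding norm_ell2_sq by (rule suminf_finite) auto
  then show ?thesis by simp
qed

lemma norm_head_tail_ell2_sq:
  "(norm (head_ell2 m' (tail_ell2 m x)))\<^sup>2 = (\<Sum>n\<in>{m..<m'}. (norm (ell2_nth x n))\<^sup>2)"
proof -
  have "(norm (head_ell2 m' (tail_ell2 m x)))\<^sup>2
      = (\<Sum>n<m'. if n \<in> {m..<m'} then (norm (ell2_nth x n))\<^sup>2 else 0)"
    unfolding norm_head_ell2_sq by (intro sum.cong) auto
  also have "\<dots> = (\<Sum>n\<in>{m..<m'}. (norm (ell2_nth x n))\<^sup>2)"
    by (simp add: sum.If_cases) (intro sum.cong; auto)
  finally show ?thesis .
qed

lemma norm_ell2_le_of_nth:
  fixes x y :: "'k::real_normed_vector ell2"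
  assumes "\<And>n. norm (ell2_nth x n) \<le> norm (ell2_nth y n)"
  shows "norm x \<le> norm y"
proof -
  have "(norm x)\<^sup>2 \<le> (norm y)\<^sup>2"
    unfolding norm_ell2_sq by (intro suminf_le) (auto intro!: power_mono assms)
  then show ?thesis
    by (rule power2_le_imp_le) simp
qed

lemma norm_tail_ell2_le: "norm (tail_ell2 m x) \<le> norm x"
  by (rule norm_ell2_le_of_nth) simp

lemma norm_head_ell2_le: "norm (head_ell2 m x) \<le> norm x"
  by (rule norm_ell2_le_of_nth) simp

lemma norm_ell2_add_disjoint_sq:
  fixes x y :: "'k::real_normed_vector ell2"
  assumes "\<And>n. ell2_nth x n = 0 \<or> ell2_nth y n = 0"
  shows "(norm (x + y))\<^sup>2 = (norm x)\<^sup>2 + (norm y)\<^sup>2"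
proof -
  have "(norm (ell2_nth (x + y) n))\<^sup>2 = (norm (ell2_nth x n))\<^sup>2 + (norm (ell2_nth y n))\<^sup>2" for n
    using assms[of n] by auto
  then show ?thesis
    unfolding norm_ell2_sq by (simp add: suminf_add)
qed

lemma tail_ell2_tendsto_0: "(\<lambda>m. norm (tail_ell2 m x)) \<longlonglongrightarrow> 0"
proof -
  have eq: "(norm (tail_ell2 m x))\<^sup>2 = (norm x)\<^sup>2 - (\<Sum>n<m. (norm (ell2_nth x n))\<^sup>2)" for m
    using norm_ell2_add_disjoint_sq[of "head_ell2 m x" "tail_ell2 m x"]
    by (simp add: norm_head_ell2_sq) (simp add: tail_ell2_def)
  have "(\<lambda>m. (norm x)\<^sup>2 - (\<Sum>n<m. (norm (ell2_nth x n))\<^sup>2)) \<longlonglongrightarrow> (norm x)\<^sup>2 - (norm x)\<^sup>2"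
    unfolding norm_ell2_sq by (intro tendsto_intros summable_LIMSEQ) auto
  then have "(\<lambda>m. (norm (tail_ell2 m x))\<^sup>2) \<longlonglongrightarrow> 0"
    unfolding eq by simp
  from tendsto_real_sqrt[OF this] show ?thesis
    by simp
qed

lemma norm_tail_ell2_small:
  assumes "0 < e" shows "\<exists>m\<ge>k. norm (tail_ell2 m x) < e"
proof -
  have "\<forall>\<^sub>F m in sequentially. norm (tail_ell2 m x) < e \<and> m \<ge> k"
    using order_tendstoD(2)[OF tail_ell2_tendsto_0 assms] eventually_ge_at_top
    by (rule eventually_conj)
  then obtain M where "\<forall>m\<ge>M. norm (tail_ell2 m x) < e \<and> m \<ge> k"
    unfolding eventually_sequentially by blast
  then show ?thesis by blast
qed

instance ell2 :: ("{real_normed_vector, complete_space}") complete_space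
proof
  fix X :: "nat \<Rightarrow> 'a ell2"
  assume X: "Cauchy X"
  have "Cauchy (\<lambda>k. ell2_nth (X k) n)" for n
    unfolding Cauchy_def
  proof (intro allI impI)
    fix e :: real assume "e > 0"
    then obtain M where "\<forall>k\<ge>M. \<forall>l\<ge>M. dist (X k) (X l) < e"
      using X \<open>e > 0\<close> unfolding Cauchy_def by blast
    then show "\<exists>M. \<forall>k\<ge>M. \<forall>l\<ge>M. dist (ell2_nth (X k) n) (ell2_nth (X l) n) < e"
      using norm_ell2_nth_le[of "X _ - X _" n] unfolding dist_norm
      by (metis order.strict_trans1 minus_ell2.rep_eq)
  qed
  then have "\<forall>n. \<exists>y. (\<lambda>k. ell2_nth (X k) n) \<longlonglongrightarrow> y"
    by (simp add: Cauchy_convergent_iff convergent_def)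
  then obtain y where y: "\<And>n. (\<lambda>k. ell2_nth (X k) n) \<longlonglongrightarrow> y n"
    by metis
  have approx: "\<exists>M. \<forall>k\<ge>M. \<forall>N. (\<Sum>n<N. (norm (ell2_nth (X k) n - y n))\<^sup>2) \<le> e\<^sup>2"
    if "e > 0" for e :: real
  proof -
    obtain M where M: "\<forall>k\<ge>M. \<forall>l\<ge>M. dist (X k) (X l) < e"
      using X \<open>e > 0\<close> unfolding Cauchy_def by blast
    have "(\<Sum>n<N. (norm (ell2_nth (X k) n - y n))\<^sup>2) \<le> e\<^sup>2" if "k \<ge> M" for k N
    proof (rule LIMSEQ_le_const2)
      show "(\<lambda>l. \<Sum>n<N. (norm (ell2_nth (X k) n - ell2_nth (X l) n))\<^sup>2)
          \<longlonglongrightarrow> (\<Sum>n<N. (norm (ell2_nth (X k) n - y n))\<^sup>2)"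
        by (intro tendsto_intros y)
      have "(\<Sum>n<N. (norm (ell2_nth (X k) n - ell2_nth (X l) n))\<^sup>2) \<le> e\<^sup>2" if "l \<ge> M" for l
      proof -
        have "(norm (X k - X l))\<^sup>2 \<le> e\<^sup>2"
          using M \<open>k \<ge> M\<close> that by (intro power_mono) (auto simp: dist_norm less_imp_le)
        then show ?thesis
          using sum_le_norm_ell2_sq[of "{..<N}" "X k - X l"] by simp
      qed
      then show "\<exists>M. \<forall>l\<ge>M. (\<Sum>n<N. (norm (ell2_nth (X k) n - ell2_nth (X l) n))\<^sup>2) \<le> e\<^sup>2"
        by blast
    qed
    then show ?thesis by blast
  qed
  obtain k where "\<forall>N. (\<Sum>n<N. (norm (ell2_nth (X k) n - y n))\<^sup>2) \<le> 1\<^sup>2"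
    using approx[of 1] by auto
  then have "summable (\<lambda>n. (norm (ell2_nth (X k) n - y n))\<^sup>2)"
    by (intro summableI_nonneg_bounded[of _ "1\<^sup>2"]) auto
  then have "summable (\<lambda>n. (norm (y n))\<^sup>2)"
    using l2_minkowski(1)[of "ell2_nth (X k)" "\<lambda>n. - (ell2_nth (X k) n - y n)"]
    by (simp add: norm_minus_commute)
  then have Y: "ell2_nth (Abs_ell2 y) = y"
    by (simp add: Abs_ell2_inverse)
  have "X \<longlonglongrightarrow> Abs_ell2 y"
  proof (rule metric_LIMSEQ_I)
    fix e :: real assume "e > 0"
    then obtain M where M: "\<forall>k\<ge>M. \<forall>N. (\<Sum>n<N. (norm (ell2_nth (X k) n - y n))\<^sup>2) \<le> (e/2)\<^sup>2"
      using approx[of "e/2"] by auto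
    have "dist (X k) (Abs_ell2 y) < e" if "k \<ge> M" for k
    proof -
      have "(norm (X k - Abs_ell2 y))\<^sup>2 \<le> (e/2)\<^sup>2"
        by (rule norm_ell2_sq_leI) (use M that Y in simp)
      then have "norm (X k - Abs_ell2 y) \<le> e/2"
        by (rule power2_le_imp_le) (use \<open>e > 0\<close> in simp)
      then show ?thesis
        using \<open>e > 0\<close> by (simp add: dist_norm)
    qed
    then show "\<exists>M. \<forall>k\<ge>M. dist (X k) (Abs_ell2 y) < e" by blast
  qed
  then show "convergent X"
    unfolding convergent_def by blast
qed

lift_definition unit_ell2 :: "nat \<Rightarrow> 'k::real_normed_field ell2"
  is "\<lambda>i n. if n = i then 1 else 0"
  by (rule summable_finite[of "{i}" for i]) auto

lemma unit_ell2_nth [simp]: "ell2_nth (unit_ell2 i) n = (if n = i then 1 else 0)"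
  by (simp add: unit_ell2.rep_eq)

lemma sum_ell2_nth: "ell2_nth (\<Sum>i\<in>A. f i) n = (\<Sum>i\<in>A. ell2_nth (f i) n)"
  by (induction A rule: infinite_finite_induct) auto

lemma head_ell2_eq_sum:
  "head_ell2 m x = (\<Sum>i<m. scale_ell2 (ell2_nth x i) (unit_ell2 i))"
proof (rule ell2_eqI)
  fix n
  have "(\<Sum>i<m. ell2_nth x i * (if n = i then 1 else 0)) = (\<Sum>i<m. if n = i then ell2_nth x i else 0)"
    by (intro sum.cong) auto
  then show "ell2_nth (head_ell2 m x) n = ell2_nth (\<Sum>i<m. scale_ell2 (ell2_nth x i) (unit_ell2 i)) n"
    by (simp add: sum_ell2_nth)
qed

lemma tail_ell2_add: "tail_ell2 m (x + y) = tail_ell2 m x + tail_ell2 m y"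
  and tail_ell2_minus: "tail_ell2 m (x - y) = tail_ell2 m x - tail_ell2 m y"
  and head_ell2_add: "head_ell2 m (x + y) = head_ell2 m x + head_ell2 m y"
  and head_ell2_minus: "head_ell2 m (x - y) = head_ell2 m x - head_ell2 m y"
  by (rule ell2_eqI; simp)+

lemma tail_ell2_scale: "tail_ell2 m (scale_ell2 c x) = scale_ell2 c (tail_ell2 m x)"
  by (rule ell2_eqI) simp

lemma tail_ell2_sum: "tail_ell2 m (\<Sum>i\<in>A. f i) = (\<Sum>i\<in>A. tail_ell2 m (f i))"
  by (rule ell2_eqI) (simp add: sum_ell2_nth)

lemma norm_head_ell2_le_sum: "norm (head_ell2 m x) \<le> (\<Sum>i<m. norm (ell2_nth x i))"
proof -
  have "norm (head_ell2 m x) = sqrt ((norm (head_ell2 m x))\<^sup>2)"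
    by simp
  also have "\<dots> = L2_set (\<lambda>i. norm (ell2_nth x i)) {..<m}"
    unfolding norm_head_ell2_sq L2_set_def ..
  also have "\<dots> \<le> (\<Sum>i<m. norm (ell2_nth x i))"
    by (intro L2_set_le_sum) auto
  finally show ?thesis .
qed

lemma scale_ell2_diff: "scale_ell2 c x - scale_ell2 c' x = scale_ell2 (c - c') x"
  by (rule ell2_eqI) (simp add: left_diff_distrib)

lemma unimodular_real:
  fixes z :: "'k::real_normed_field"
  shows "\<exists>\<theta>. norm \<theta> = 1 \<and> \<theta> * z = of_real (norm z)"
proof (cases "z = 0")
  case False
  then show ?thesis
    by (intro exI[of _ "of_real (norm z) / z"]) (simp add: norm_divide)
qed (auto intro: exI[of _ 1])

text \<open>
  A bounded functional \<open>g\<close> is given by a square-summable sequence: testing \<open>g\<close> on the finite vectors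
  whose entries are the unimodular multiples of \<open>norm (g e\<^sub>i)\<close> that make the value of \<open>g\<close> equal to
  \<open>\<Sum>(norm (g e\<^sub>i))\<^sup>2\<close> bounds that sum by \<open>C\<^sup>2\<close>. Cauchy-Schwarz then controls \<open>g\<close> on tails.
\<close>

lemma ell2_functional_tail:
  fixes g :: "'k::real_normed_field ell2 \<Rightarrow> 'k"
  assumes add: "\<And>x y. g (x + y) = g x + g y"
    and scale: "\<And>c x. g (scale_ell2 c x) = c * g x"
    and bound: "\<And>x. norm (g x) \<le> C * norm x"
    and e: "0 < e"
  shows "\<exists>M. \<forall>m\<ge>M. \<forall>x. norm (g (tail_ell2 m x)) \<le> e * norm x"
proof -
  define c where "c i = g (unit_ell2 i)" for i
  have g0: "g 0 = 0" using add[of 0 0] by simp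
  have gsum: "g (\<Sum>i\<in>A. scale_ell2 (t i) (unit_ell2 i)) = (\<Sum>i\<in>A. t i * c i)" for t and A :: "nat set"
    by (induction A rule: infinite_finite_induct) (auto simp: g0 add scale c_def)
  have C0: "0 \<le> C"
    using bound[of "unit_ell2 0"] norm_ge_zero[of "g (unit_ell2 0)"] norm_ell2_nth_le[of "unit_ell2 0 :: 'k ell2" 0]
    by (smt (verit) mult_neg_pos norm_one unit_ell2_nth)
  have "\<forall>i. \<exists>t. norm t = 1 \<and> t * c i = of_real (norm (c i))"
    using unimodular_real by blast
  then obtain t where t: "\<And>i. norm (t i) = 1" "\<And>i. t i * c i = of_real (norm (c i))"
    by metis
  have part: "(\<Sum>i<N. (norm (c i))\<^sup>2) \<le> C\<^sup>2" for N
  proof -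
    let ?S = "\<Sum>i<N. (norm (c i))\<^sup>2"
    define x where "x = (\<Sum>i<N. scale_ell2 (of_real (norm (c i)) * t i) (unit_ell2 i))"
    have xn: "ell2_nth x n = (if n < N then of_real (norm (c n)) * t n else 0)" for n
    proof -
      have "ell2_nth x n = (\<Sum>i<N. if n = i then of_real (norm (c i)) * t i else 0)"
        unfolding x_def sum_ell2_nth by (intro sum.cong) auto
      then show ?thesis by simp
    qed
    have "x = head_ell2 N x"
      by (rule ell2_eqI) (simp add: xn)
    then have "(norm x)\<^sup>2 = (\<Sum>n<N. (norm (ell2_nth x n))\<^sup>2)"
      by (metis norm_head_ell2_sq)
    also have "\<dots> = ?S"
      by (intro sum.cong) (auto simp: xn norm_mult t)
    finally have nx: "(norm x)\<^sup>2 = ?S" .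
    have "g x = (\<Sum>i<N. of_real ((norm (c i))\<^sup>2))"
      unfolding x_def gsum by (intro sum.cong refl) (simp add: mult.assoc t power2_eq_square)
    also have "\<dots> = of_real ?S" by simp
    finally have "norm (g x) = (norm x)\<^sup>2"
      unfolding nx by (simp only: norm_of_real) (simp add: sum_nonneg)
    then have "norm x * norm x \<le> C * norm x"
      using bound[of x] by (simp add: power2_eq_square)
    then have "norm x \<le> C"
      using C0 by (cases "norm x = 0") auto
    then show ?thesis
      unfolding nx[symmetric] by (intro power_mono) auto
  qed
  have "summable (\<lambda>i. (norm (c i))\<^sup>2)"
    by (rule summableI_nonneg_bounded[OF _ part]) auto
  then have cn: "ell2_nth (Abs_ell2 c) = c"
    by (simp add: Abs_ell2_inverse)
  obtain M where M: "norm (tail_ell2 M (Abs_ell2 c)) < e"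
    using norm_tail_ell2_small[OF e] by blast
  have "norm (g (tail_ell2 m x)) \<le> e * norm x" if "m \<ge> M" for m x
  proof -
    have fin: "norm (g (head_ell2 N (tail_ell2 m x))) \<le> e * norm x" for N
    proof -
      let ?c = "tail_ell2 M (Abs_ell2 c)"
      have "norm (g (head_ell2 N (tail_ell2 m x)))
          = norm (\<Sum>i<N. ell2_nth (tail_ell2 m x) i * ell2_nth ?c i)"
        unfolding head_ell2_eq_sum gsum using that
        by (intro arg_cong[of _ _ norm] sum.cong) (auto simp: cn)
      also have "\<dots> \<le> (\<Sum>i<N. \<bar>norm (ell2_nth (tail_ell2 m x) i)\<bar> * \<bar>norm (ell2_nth ?c i)\<bar>)"
        by (rule order_trans[OF norm_sum]) (simp add: norm_mult)
      also have "\<dots> \<le> L2_set (\<lambda>i. norm (ell2_nth (tail_ell2 m x) i)) {..<N} * L2_set (\<lambda>i. norm (ell2_nth ?c i)) {..<N}"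
        by (rule L2_set_mult_ineq)
      also have "\<dots> \<le> norm (tail_ell2 m x) * norm ?c"
        unfolding L2_set_def
          by (intro mult_mono real_le_lsqrt sum_le_norm_ell2_sq sum_nonneg real_sqrt_ge_zero) auto
      also have "\<dots> \<le> norm x * e"
        using M by (intro mult_mono norm_tail_ell2_le) auto
      finally show ?thesis by (simp add: mult.commute)
    qed
    let ?y = "tail_ell2 m x"
    have "(\<lambda>N. e * norm x + C * norm (tail_ell2 N ?y)) \<longlonglongrightarrow> e * norm x + C * 0"
      by (intro tendsto_intros tail_ell2_tendsto_0)
    moreover have "norm (g ?y) \<le> e * norm x + C * norm (tail_ell2 N ?y)" for N
    proof -
      have "g ?y = g (head_ell2 N ?y) + g (tail_ell2 N ?y)"
        unfolding add[symmetric] by (simp add: tail_ell2_def)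
      then show ?thesis
        using fin[of N] bound[of "tail_ell2 N ?y"] norm_triangle_ineq
        by (metis add_mono order_trans)
    qed
    ultimately show ?thesis
      by (intro LIMSEQ_le_const[where X="\<lambda>N. e * norm x + C * norm (tail_ell2 N ?y)"]) auto
  qed
  then show ?thesis by blast
qed

section \<open>Bounded sequences\<close>

lemma norm_scale_linf: "norm (scale_linf c x) \<le> norm c * norm (x :: 'k::real_normed_field linf)"
  by (rule norm_bound) (simp add: scale_linf_apply norm_mult mult_left_mono norm_bounded)

lemma diff_eq_scale: "x - y = x + scale_linf (-1) (y :: 'k::real_normed_field linf)"
  by (rule bcontfun_eqI) (simp add: scale_linf_apply)

text \<open>
  Cauchy sequences converge uniformly, and uniform limits of bounded functions are bounded.
\<close>

lemma complete_linf: "complete (UNIV :: 'k::complete_space linf set)"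
  unfolding complete_def
proof (intro allI impI)
  fix f :: "nat \<Rightarrow> 'k linf"
  assume "(\<forall>n. f n \<in> UNIV) \<and> Cauchy f"
  then have "Cauchy f" ..
  then obtain g where "uniform_limit UNIV (\<lambda>n. apply_bcontfun (f n)) g sequentially"
    using uniformly_convergent_eq_cauchy[of "\<lambda>_. True" "\<lambda>n. apply_bcontfun (f n)"]
    unfolding Cauchy_def uniform_limit_sequentially_iff
    by (metis dist_fun_lt_imp_dist_val_lt)
  from uniform_limit_bcontfunE[OF this sequentially_bot]
  obtain l where "g = apply_bcontfun l" "f \<longlonglongrightarrow> l" by metis
  then show "\<exists>l\<in>UNIV. f \<longlonglongrightarrow> l" by blast
qed

lemma scale_linf_diff: "scale_linf c x - scale_linf c' x = scale_linf (c - c') x"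
  by (rule bcontfun_eqI) (simp add: scale_linf_apply left_diff_distrib)

lemma sum_linf_apply: "apply_bcontfun (\<Sum>i\<in>A. f i) k = (\<Sum>i\<in>A. apply_bcontfun (f i) k)"
  by (induction A rule: infinite_finite_induct) simp_all

section \<open>Compactness by finite-rank approximation\<close>

text \<open>
  Total boundedness: it suffices that the image of the unit ball stays arbitrarily close to compact sets.
\<close>

lemma compact_operatorI:
  fixes T :: "'v::real_normed_vector \<Rightarrow> 'w::real_normed_vector"
  assumes "complete W"
    and approx: "\<And>e. 0 < e \<Longrightarrow> \<exists>K. compact K \<and> (\<forall>x\<in>V. norm x \<le> 1 \<longrightarrow> (\<exists>y\<in>K. dist (T x) y < e))"
  shows "compact_operator V W T"
  unfolding compact_operator_def compact_eq_totally_bounded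
proof (intro conjI allI impI)
  let ?S = "T ` {x \<in> V. norm x \<le> 1}"
  show "complete (W \<inter> closure ?S)"
    using assms(1) by (simp add: complete_Int_closed)
  fix e :: real assume e: "0 < e"
  then obtain K where K: "compact K" "\<forall>x\<in>V. norm x \<le> 1 \<longrightarrow> (\<exists>y\<in>K. dist (T x) y < e/3)"
    using approx[of "e/3"] by auto
  obtain k where k: "finite k" "K \<subseteq> (\<Union>c\<in>k. ball c (e/3))"
    using K(1) e unfolding compact_eq_totally_bounded by (meson divide_pos_pos zero_less_numeral)
  have "z \<in> (\<Union>c\<in>k. ball c e)" if z: "z \<in> closure ?S" for z
  proof -
    obtain x where x: "x \<in> V" "norm x \<le> 1" "dist (T x) z < e/3"
      using z e closure_approachable[of z ?S] by (auto dest: spec[of _ "e/3"])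
    obtain y where y: "y \<in> K" "dist (T x) y < e/3"
      using K(2) x by blast
    obtain c where c: "c \<in> k" "dist c y < e/3"
      using k(2) y by auto
    have "dist c z \<le> dist c y + dist (T x) y + dist (T x) z"
      using dist_triangle[of c z y] dist_triangle[of y z "T x"] by (simp add: dist_commute)
    then have "dist c z < e" using x y c by simp
    then show ?thesis using c by auto
  qed
  then show "\<exists>k. finite k \<and> W \<inter> closure ?S \<subseteq> (\<Union>c\<in>k. ball c e)"
    using k(1) by blast
qed

text \<open>
  The compact sets in question come from finite-rank approximations. Sums with bounded coefficients are
  built up one summand at a time; each summand ranges over the continuous image of a ball of scalars,
  which is compact because the scalar field is locally compact.
\<close>

lemma compact_linear_combinations:
  fixes s :: "'k::{real_normed_field,heine_borel} \<Rightarrow> 'v \<Rightarrow> 'v::real_normed_vector" and m :: nat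
  assumes diff: "\<And>c c' v. s c v - s c' v = s (c - c') v"
    and norm: "\<And>c v. norm (s c v) \<le> norm c * norm v"
  shows "\<exists>K. compact K \<and> (\<forall>c. (\<forall>i. norm (c i) \<le> R) \<longrightarrow> (\<Sum>i<m. s (c i) (v i)) \<in> K)"
proof (induction m)
  case 0
  show ?case by (intro exI[of _ "{0}"]) auto
next
  case (Suc m)
  then obtain K where K: "compact K" "\<forall>c. (\<forall>i. norm (c i) \<le> R) \<longrightarrow> (\<Sum>i<m. s (c i) (v i)) \<in> K"
    by blast
  have "(norm (v m))-lipschitz_on (cball 0 R) (\<lambda>c. s c (v m))"
  proof (rule lipschitz_onI)
    show "dist (s c (v m)) (s c' (v m)) \<le> norm (v m) * dist c c'" for c c'
      using norm[of "c - c'" "v m"] by (simp add: dist_norm diff mult.commute)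
  qed simp
  then have "compact ((\<lambda>c. s c (v m)) ` cball 0 R)"
    by (intro compact_continuous_image lipschitz_on_continuous_on compact_cball)
  then have "compact {x + y |x y. x \<in> K \<and> y \<in> (\<lambda>c. s c (v m)) ` cball 0 R}"
    using K(1) by (intro compact_sums)
  moreover have "(\<Sum>i<Suc m. s (c i) (v i)) \<in> {x + y |x y. x \<in> K \<and> y \<in> (\<lambda>c. s c (v m)) ` cball 0 R}"
    if "\<forall>i. norm (c i) \<le> R" for c
  proof -
    have "(\<Sum>i<Suc m. s (c i) (v i)) = (\<Sum>i<m. s (c i) (v i)) + s (c m) (v m)" by simp
    moreover have "(\<Sum>i<m. s (c i) (v i)) \<in> K" "s (c m) (v m) \<in> (\<lambda>c. s c (v m)) ` cball 0 R"
      using that K(2) by auto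
    ultimately show ?thesis by blast
  qed
  ultimately show ?case by blast
qed

section \<open>The extension operators of the construction\<close>

text \<open>
  The part of the construction that the analysis uses. \<open>E n u\<close> is the image under \<open>i\<^sub>n\<close> of the first
  \<open>d n\<close> entries of the sequence \<open>u\<close>; entries of \<open>u\<close> beyond these are ignored, which makes \<open>E n\<close> total and
  turns the projection onto the \<open>n\<close>-th subspace into \<open>E n\<close> itself. The two coordinate assumptions say
  that the new coordinates of each level are functionals of the prescribed form, and that each tuple
  with both signs positive really occurs as a coordinate.
\<close>

locale bd_system =
  fixes a b lam :: real and d :: "nat \<Rightarrow> nat"
    and E :: "nat \<Rightarrow> (nat \<Rightarrow> 'k) \<Rightarrow> nat \<Rightarrow> 'k::{real_normed_field,heine_borel}"
  assumes b_pos: "0 < b" and b_less_a: "b < a" and a_less_1: "a < 1"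
    and cubes: "a ^ 3 + b ^ 3 = 1"
    and lam_gt_1: "1 < lam" and lam_ineq: "a + 2 * b * lam \<le> lam"
    and d_mono: "n \<le> n' \<Longrightarrow> d n \<le> d n'"
    and d_ge: "n \<le> d n"
    and E_cong: "(\<And>k. k < d n \<Longrightarrow> u k = v k) \<Longrightarrow> E n u = E n v"
    and E_add: "E n (\<lambda>k. u k + v k) k = E n u k + E n v k"
    and E_scale: "E n (\<lambda>k. c * u k) k = c * E n u k"
    and E_extends: "k < d n \<Longrightarrow> E n u k = u k"
    and E_E: "m \<le> n \<Longrightarrow> E n (E m u) = E m u"
    and coordinate_cases: "d n \<le> k \<Longrightarrow> k < d (Suc n) \<Longrightarrow>
        \<exists>m<n. \<exists>i<d m. \<exists>j<d n. \<exists>e'\<in>{1, -1}. \<exists>e''\<in>{1, -1}. \<forall>u.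
          E n u k = e' * of_real a * u i + e'' * of_real b * (u j - E m u j)"
    and coordinate_exists: "m < n \<Longrightarrow> i < d m \<Longrightarrow> j < d n \<Longrightarrow>
        \<exists>k<d (Suc n). \<forall>u. E n u k = of_real a * u i + of_real b * (u j - E m u j)"

context
  fixes a b :: real and d :: "nat \<Rightarrow> nat"
    and inc :: "nat \<Rightarrow> nat \<Rightarrow> (nat \<Rightarrow> 'k) \<Rightarrow> nat \<Rightarrow> 'k::{real_normed_field,heine_borel}"
  assumes bd: "bd_construction a b d inc"
begin

text \<open>
  The map \<open>i\<^bsub>m,n\<^esub>\<close>, extended to \<open>m = n\<close> by the identity of the coordinate space, so that composition and
  linearity can be proved by induction on \<open>n\<close> from a trivial base case.
\<close>

definition stage :: "nat \<Rightarrow> nat \<Rightarrow> (nat \<Rightarrow> 'k) \<Rightarrow> nat \<Rightarrow> 'k" where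
  "stage m n u = (if m < n then inc m n (coord_proj (d m) u) else coord_proj (d m) u)"

lemma coord_proj_mem: "coord_proj k u \<in> coord_space k"
  by (simp add: coord_proj_def coord_space_def)

lemma coord_proj_id: "u \<in> coord_space k \<Longrightarrow> coord_proj k u = u"
  by (force simp: coord_proj_def coord_space_def)

lemma d_Suc: "d (Suc n) = d n + card (bd_functionals a b d inc n)"
  using bd by (simp add: bd_construction_def)

lemma d_incseq: "n \<le> n' \<Longrightarrow> d n \<le> d n'"
  by (rule lift_Suc_mono_le) (simp_all add: d_Suc)

lemma bd_functionals_memI:
  assumes "m < n" "i < d m" "j < d n"
  shows "(\<lambda>x\<in>coord_space (d n). 1 * of_real a * x i +
      1 * of_real b * (x j - inc m n (coord_proj (d m) x) j)) \<in> bd_functionals a b d inc n"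
proof -
  have "(1::'k) \<in> {1, -1}" by simp
  then show ?thesis
    unfolding bd_functionals_def mem_Collect_eq using assms by (intro exI conjI) (rule refl, assumption+)
qed

lemma d_lower: "n \<le> d n"
proof (induction n)
  case (Suc n)
  have d0: "d 0 = 1" using bd by (simp add: bd_construction_def)
  show ?case
  proof (cases "n = 0")
    case True
    then show ?thesis using d_incseq[of 0 1] d0 by simp
  next
    case False
    have "0 < d n" using d_incseq[of 0 n] d0 by simp
    then have "bd_functionals a b d inc n \<noteq> {}"
      using bd_functionals_memI[of 0 n 0 0] False d0 by auto
    then have "0 < card (bd_functionals a b d inc n)"
      by (simp add: card_gt_0_iff finite_bd_functionals)
    then show ?thesis using Suc by (simp add: d_Suc)
  qed
qed simp

lemma inc_step:
  "\<exists>enum. bij_betw enum {d n..<d (Suc n)} (bd_functionals a b d inc n) \<and>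
        (\<forall>x\<in>coord_space (d n). inc n (Suc n) x =
           (\<lambda>k. if k < d n then x k else if k < d (Suc n) then enum k x else 0))"
  using bd unfolding bd_construction_def by (elim conjE) (erule allE)

lemma inc_step_mem: "x \<in> coord_space (d n) \<Longrightarrow> inc n (Suc n) x \<in> coord_space (d (Suc n))"
  using inc_step[of n] d_incseq[of n "Suc n"] by (auto simp: coord_space_def)

lemma inc_step_below: "x \<in> coord_space (d n) \<Longrightarrow> k < d n \<Longrightarrow> inc n (Suc n) x k = x k"
  using inc_step[of n] by auto

lemma inc_Suc:
  "m < n \<Longrightarrow> x \<in> coord_space (d m) \<Longrightarrow> inc m (Suc n) x = inc n (Suc n) (inc m n x)"
  using bd by (simp add: bd_construction_def)

lemma stage_self: "stage n n u = coord_proj (d n) u"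
  by (simp add: stage_def)

lemma stage_Suc: "m \<le> n \<Longrightarrow> stage m (Suc n) u = inc n (Suc n) (stage m n u)"
  by (auto simp: stage_def inc_Suc coord_proj_mem le_less)

lemma stage_mem: "m \<le> n \<Longrightarrow> stage m n u \<in> coord_space (d n)"
  by (induction n rule: dec_induct) (simp_all add: stage_self coord_proj_mem stage_Suc inc_step_mem)

lemma stage_below: "m \<le> n \<Longrightarrow> k < d m \<Longrightarrow> stage m n u k = u k"
proof (induction n rule: dec_induct)
  case base
  then show ?case by (simp add: stage_self coord_proj_def)
next
  case (step n)
  have "k < d n"
    using step d_incseq[of m n] by simp
  then show ?case
    using step by (simp add: stage_Suc stage_mem inc_step_below)
qed

lemma stage_stage:
  assumes "n \<le> l" "m \<le> n"
  shows "stage n l (stage m n u) = stage m l u"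
  using assms(1)
proof (induction l rule: dec_induct)
  case base
  then show ?case
    using assms by (simp add: stage_self coord_proj_id stage_mem)
next
  case (step l)
  then show ?case
    using assms by (simp add: stage_Suc)
qed

lemma stage_cong: "(\<And>k. k < d m \<Longrightarrow> u k = v k) \<Longrightarrow> stage m n u = stage m n v"
proof -
  assume "\<And>k. k < d m \<Longrightarrow> u k = v k"
  then have "coord_proj (d m) u = coord_proj (d m) v"
    by (auto simp: coord_proj_def)
  then show ?thesis by (simp add: stage_def)
qed

lemma stage_later:
  assumes "m \<le> n" "n \<le> l" "k < d n"
  shows "stage m l u k = stage m n u k"
  using assms stage_stage[of n l m u] stage_below[of n l k "stage m n u"] by simp

lemma functional_on_stage:
  assumes "m < n" "j < d n" "x \<in> coord_space (d n)"
  shows "inc m n (coord_proj (d m) x) j = stage m n x j"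
  using assms by (simp add: stage_def)

text \<open>
  Linearity has to be proved for all \<open>m\<close> at once: the functionals that define level \<open>n + 1\<close> involve the maps
  \<open>i\<^bsub>m,n\<^esub>\<close> for every \<open>m < n\<close>.
\<close>

lemma stage_linear:
  "m \<le> n \<Longrightarrow> stage m n (\<lambda>k. c * u k + c' * v k) = (\<lambda>k. c * stage m n u k + c' * stage m n v k)"
proof (induction n arbitrary: m u v c c' rule: less_induct)
  case (less n)
  show ?case
  proof (cases "m = n")
    case True
    then show ?thesis by (auto simp: stage_self coord_proj_def)
  next
    case False
    then obtain l where n: "n = Suc l" and ml: "m \<le> l"
      using less.prems by (cases n) auto
    let ?x = "stage m l u" and ?y = "stage m l v"
    let ?z = "\<lambda>k. c * ?x k + c' * ?y k"
    have xyz: "?x \<in> coord_space (d l)" "?y \<in> coord_space (d l)" "?z \<in> coord_space (d l)"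
      using stage_mem[OF ml] by (auto simp: coord_space_def)
    obtain enum where en: "bij_betw enum {d l..<d (Suc l)} (bd_functionals a b d inc l)"
      and inc: "\<forall>x\<in>coord_space (d l). inc l (Suc l) x =
           (\<lambda>k. if k < d l then x k else if k < d (Suc l) then enum k x else 0)"
      using inc_step[of l] by (elim exE conjE)
    have "enum k ?z = c * enum k ?x + c' * enum k ?y" if "d l \<le> k" "k < d (Suc l)" for k
    proof -
      have "enum k \<in> bd_functionals a b d inc l"
        using en that by (auto simp: bij_betw_def)
      then obtain m' i j e' e'' where f: "enum k = (\<lambda>x\<in>coord_space (d l).
         e' * of_real a * x i + e'' * of_real b * (x j - inc m' l (coord_proj (d m') x) j))"
        and m': "m' < l" and j: "j < d l"
        unfolding bd_functionals_def mem_Collect_eq by (elim exE conjE)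
      have "stage m' l ?z = (\<lambda>k. c * stage m' l ?x k + c' * stage m' l ?y k)"
        using less.IH[of l m'] m' n by simp
      then show ?thesis
        unfolding f restrict_apply using xyz
        by (simp add: functional_on_stage[OF m' j] algebra_simps)
    qed
    then have "inc l (Suc l) ?z = (\<lambda>k. c * inc l (Suc l) ?x k + c' * inc l (Suc l) ?y k)"
      unfolding inc[rule_format, OF xyz(1)] inc[rule_format, OF xyz(2)] inc[rule_format, OF xyz(3)]
      by (intro ext) auto
    moreover have "stage m l (\<lambda>k. c * u k + c' * v k) = ?z"
      using less.IH[of l m] ml n by simp
    ultimately show ?thesis
      using stage_Suc[OF ml] n by simp
  qed
qed

abbreviation extension :: "nat \<Rightarrow> (nat \<Rightarrow> 'k) \<Rightarrow> nat \<Rightarrow> 'k" where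
  "extension n u \<equiv> bd_embedding inc n (coord_proj (d n) u)"

text \<open>
  A coordinate is never changed after the level that creates it, so the coordinatewise limit is the limit
  of an eventually constant sequence.
\<close>

lemma extension_eq_stage:
  assumes "m \<le> n" "k < d n"
  shows "extension m u k = stage m n u k"
proof -
  have "\<forall>\<^sub>F l in sequentially. inc m l (coord_proj (d m) u) k = stage m n u k"
    using eventually_gt_at_top[of n]
  proof eventually_elim
    case (elim l)
    then have "inc m l (coord_proj (d m) u) = stage m l u"
      using assms(1) by (simp add: stage_def)
    then show ?case
      using stage_later[of m n l k u] elim assms by (simp only: less_imp_le)
  qed
  then have "(\<lambda>l. inc m l (coord_proj (d m) u) k) \<longlonglongrightarrow> stage m n u k"
    by (rule tendsto_eventually)
  then show ?thesis
    unfolding bd_embedding_def by (rule limI)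
qed

lemma extension_eq_stage':
  "\<exists>n\<ge>m. k < d n \<and> (\<forall>u. extension m u k = stage m n u k)"
proof (intro exI conjI allI)
  let ?n = "m + Suc k"
  show "k < d ?n" using d_lower[of ?n] by simp
  then show "extension m u k = stage m ?n u k" for u
    by (intro extension_eq_stage) auto
qed auto

lemma extension_level:
  "\<exists>enum. bij_betw enum {d n..<d (Suc n)} (bd_functionals a b d inc n) \<and>
     (\<forall>k u. d n \<le> k \<longrightarrow> k < d (Suc n) \<longrightarrow> extension n u k = enum k (coord_proj (d n) u))"
proof -
  obtain enum where en: "bij_betw enum {d n..<d (Suc n)} (bd_functionals a b d inc n)"
    and inc: "\<forall>x\<in>coord_space (d n). inc n (Suc n) x =
         (\<lambda>k. if k < d n then x k else if k < d (Suc n) then enum k x else 0)"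
    using inc_step[of n] by (elim exE conjE)
  have "extension n u k = enum k (coord_proj (d n) u)" if "d n \<le> k" "k < d (Suc n)" for u k
    using that extension_eq_stage[of n "Suc n" k u]
    by (simp add: stage_Suc stage_self inc coord_proj_mem)
  then show ?thesis
    by (intro exI[of _ enum] conjI en allI impI)
qed

lemma functional_on_extension:
  assumes "m < n" "i < d m" "j < d n"
  shows "(\<lambda>x\<in>coord_space (d n). e' * of_real a * x i +
      e'' * of_real b * (x j - inc m n (coord_proj (d m) x) j)) (coord_proj (d n) u)
    = e' * of_real a * u i + e'' * of_real b * (u j - extension m u j)"
proof -
  have "d m \<le> d n" using assms by (intro d_incseq) simp
  then have "stage m n (coord_proj (d n) u) = stage m n u"
    by (intro stage_cong) (simp add: coord_proj_def)
  then have "inc m n (coord_proj (d m) (coord_proj (d n) u)) j = extension m u j"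
    using assms by (simp only: functional_on_stage coord_proj_mem extension_eq_stage[of m n] less_imp_le)
  moreover have "coord_proj (d n) u i = u i" "coord_proj (d n) u j = u j"
    using assms \<open>d m \<le> d n\<close> by (simp_all add: coord_proj_def)
  ultimately show ?thesis
    by (simp only: restrict_apply coord_proj_mem if_True)
qed

lemma bd_system_extension:
  assumes "0 < b" "b < a" "a < 1" "a ^ 3 + b ^ 3 = 1" "1 < lam" "a + 2 * b * lam \<le> lam"
  shows "bd_system a b lam d extension"
proof
  show "0 < b" "b < a" "a < 1" "a ^ 3 + b ^ 3 = 1" "1 < lam" "a + 2 * b * lam \<le> lam"
    by fact+
  show "d n \<le> d n'" if "n \<le> n'" for n n'
    using that by (rule d_incseq)
  show "n \<le> d n" for n by (rule d_lower)
  show "extension n u = extension n v" if "\<And>k. k < d n \<Longrightarrow> u k = v k" for n u v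
  proof -
    have "coord_proj (d n) u = coord_proj (d n) v"
      using that by (auto simp: coord_proj_def)
    then show ?thesis by simp
  qed
  show "extension n (\<lambda>k. u k + v k) k = extension n u k + extension n v k" for n k u v
  proof -
    obtain l where "n \<le> l" "\<forall>u. extension n u k = stage n l u k"
      using extension_eq_stage'[of n k] by blast
    then show ?thesis using stage_linear[of n l 1 u 1 v] by simp
  qed
  show "extension n (\<lambda>k. c * u k) k = c * extension n u k" for n k c u
  proof -
    obtain l where "n \<le> l" "\<forall>u. extension n u k = stage n l u k"
      using extension_eq_stage'[of n k] by blast
    then show ?thesis using stage_linear[of n l c u 0 u] by simp
  qed
  show "extension n u k = u k" if "k < d n" for n u k
    using that extension_eq_stage[of n n k u] by (simp add: stage_self coord_proj_def)
  show "extension n (extension m u) = extension m u" if "m \<le> n" for m n u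
  proof
    fix k
    obtain l where l: "n \<le> l" "k < d l" "\<forall>u. extension n u k = stage n l u k"
      using extension_eq_stage'[of n k] by blast
    have "stage n l (extension m u) = stage n l (stage m n u)"
      using that by (intro stage_cong extension_eq_stage)
    then show "extension n (extension m u) k = extension m u k"
      using that l stage_stage[of n l m u] extension_eq_stage[of m l k u] by simp
  qed
  show "\<exists>m<n. \<exists>i<d m. \<exists>j<d n. \<exists>e'\<in>{1, -1}. \<exists>e''\<in>{1, -1}. \<forall>u.
      extension n u k = e' * of_real a * u i + e'' * of_real b * (u j - extension m u j)"
    if "d n \<le> k" "k < d (Suc n)" for n k
  proof -
    obtain enum where en: "bij_betw enum {d n..<d (Suc n)} (bd_functionals a b d inc n)"
      "\<forall>k u. d n \<le> k \<longrightarrow> k < d (Suc n) \<longrightarrow> extension n u k = enum k (coord_proj (d n) u)"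
      using extension_level[of n] by (elim exE conjE)
    then have "enum k \<in> bd_functionals a b d inc n"
      using that by (auto simp: bij_betw_def)
    then obtain m i j e' e'' where f:
      "enum k = (\<lambda>x\<in>coord_space (d n).
         e' * of_real a * x i + e'' * of_real b * (x j - inc m n (coord_proj (d m) x) j))"
      "m < n" "i < d m" "j < d n" "e' \<in> {1, -1}" "e'' \<in> {1, -1}"
      unfolding bd_functionals_def mem_Collect_eq by (elim exE conjE)
    have "\<forall>u. extension n u k = e' * of_real a * u i + e'' * of_real b * (u j - extension m u j)"
      using en(2) that by (simp only: f(1) functional_on_extension[OF f(2-4)] simp_thms)
    then show ?thesis
      using f(2-6) by blast
  qed
  show "\<exists>k<d (Suc n). \<forall>u. extension n u k = of_real a * u i + of_real b * (u j - extension m u j)"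
    if "m < n" "i < d m" "j < d n" for m n i j
  proof -
    let ?f = "\<lambda>x\<in>coord_space (d n).
         1 * of_real a * x i + 1 * of_real b * (x j - inc m n (coord_proj (d m) x) j)"
    have f: "?f \<in> bd_functionals a b d inc n"
      by (rule bd_functionals_memI[OF that])
    obtain enum where en: "bij_betw enum {d n..<d (Suc n)} (bd_functionals a b d inc n)"
      "\<forall>k u. d n \<le> k \<longrightarrow> k < d (Suc n) \<longrightarrow> extension n u k = enum k (coord_proj (d n) u)"
      using extension_level[of n] by (elim exE conjE)
    have "?f \<in> enum ` {d n..<d (Suc n)}"
      using f en(1) by (simp only: bij_betw_def)
    then obtain k where k: "enum k = ?f" "d n \<le> k" "k < d (Suc n)"
      by auto
    have "extension n u k = of_real a * u i + of_real b * (u j - extension m u j)" for u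
      using en(2) k(2,3) functional_on_extension[OF that, of 1 1 u] by (simp only: k(1) mult_1)
    then show ?thesis
      using k(3) by blast
  qed
qed

end

section \<open>Projections onto the finite-dimensional subspaces\<close>

context bd_system
begin

lemma E_zero: "E n (\<lambda>k. 0) k = 0"
  using E_scale[of n 0 "\<lambda>k. 0"] by simp

lemma d_unbounded: "k < d (Suc k)"
  using d_ge[of "Suc k"] by simp

lemma level_exists:
  assumes "d m \<le> k"
  shows "\<exists>n\<ge>m. d n \<le> k \<and> k < d (Suc n)"
proof -
  define l where "l = (LEAST l. k < d l)"
  have l: "k < d l"
    unfolding l_def by (rule LeastI[of _ "Suc k"]) (rule d_unbounded)
  have "m < l"
    using assms l d_mono[of l m] by (cases "m < l") auto
  then obtain n where n: "l = Suc n" "m \<le> n"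
    by (cases l) auto
  have "\<not> k < d n"
    using not_less_Least[of n "\<lambda>l. k < d l"] n unfolding l_def by simp
  then show ?thesis
    using n l by auto
qed

text \<open>
  The bound \<open>\<parallel>i\<^sub>m\<parallel> \<le> \<lambda>\<close>, by induction on the coordinate. Let \<open>v = i\<^sub>m u\<close> and let the coordinate \<open>k\<close> come from
  \<open>(l, i, j)\<close>. If \<open>m \<le> l\<close>, then \<open>v - P\<^sub>l v = 0\<close> and \<open>v k = \<plusminus>a v i\<close>. If \<open>l < m\<close>, then \<open>v i = u i\<close> is bounded by
  \<open>M\<close> rather than \<open>\<lambda> M\<close>, and the claim is \<open>a + 2 b \<lambda> \<le> \<lambda>\<close>.
\<close>

lemma norm_E_le:
  assumes "\<And>i. i < d m \<Longrightarrow> norm (u i) \<le> M" and M: "0 \<le> M"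
  shows "norm (E m u k) \<le> lam * M"
  using assms(1)
proof (induction k arbitrary: m rule: less_induct)
  case (less k)
  have M_le: "M \<le> lam * M"
    using M lam_gt_1 mult_right_mono[of 1 lam M] by simp
  show ?case
  proof (cases "k < d m")
    case True
    then show ?thesis
      using less.prems M_le E_extends[of k m u] by (metis order_trans)
  next
    case False
    then obtain n where n: "m \<le> n" "d n \<le> k" "k < d (Suc n)"
      using level_exists[of m k] by auto
    let ?v = "E m u"
    obtain l i j e' e'' where l: "l < n" "i < d l" "j < d n"
      and sgn: "e' \<in> {1, -1}" "e'' \<in> {1, -1}"
      and eq: "\<And>u. E n u k = e' * of_real a * u i + e'' * of_real b * (u j - E l u j)"
      using coordinate_cases[OF n(2,3)] by blast
    have v: "?v k = e' * of_real a * ?v i + e'' * of_real b * (?v j - E l ?v j)"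
      using eq[of ?v] E_E[OF n(1)] by simp
    have ne: "norm e' = 1" "norm e'' = 1"
      using sgn by auto
    have ij: "i < k" "j < k"
      using l n d_mono[of l n] by auto
    have vj: "norm (?v j) \<le> lam * M"
      using less.IH[OF ij(2)] less.prems by blast
    have a0: "0 < a" using b_pos b_less_a by simp
    show ?thesis
    proof (cases "m \<le> l")
      case True
      then have "norm (?v k) = a * norm (?v i)"
        using v a0 by (simp add: E_E norm_mult ne)
      also have "\<dots> \<le> 1 * (lam * M)"
        using less.IH[OF ij(1)] less.prems a_less_1 a0 by (intro mult_mono) auto
      finally show ?thesis by simp
    next
      case False
      have lm: "d l \<le> d m"
        using False by (intro d_mono) simp
      then have "E l ?v = E l u"
        by (intro E_cong E_extends) simp
      moreover have "norm (E l u j) \<le> lam * M"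
        using less.IH[OF ij(2), of l] less.prems lm by auto
      ultimately have "norm (?v j - E l ?v j) \<le> lam * M + lam * M"
        using vj by (simp only:) (rule order_trans[OF norm_triangle_ineq4 add_mono])
      then have 1: "norm (e'' * of_real b * (?v j - E l ?v j)) \<le> b * (lam * M + lam * M)"
        using b_pos by (simp add: norm_mult ne mult_left_mono)
      have "norm (?v i) \<le> M"
        using less.prems l lm E_extends[of i m u] by auto
      then have 2: "norm (e' * of_real a * ?v i) \<le> a * M"
        using a0 by (simp add: norm_mult ne mult_left_mono)
      have "norm (?v k) \<le> a * M + b * (lam * M + lam * M)"
        unfolding v using norm_triangle_ineq 1 2 by (metis add_mono order_trans)
      also have "\<dots> = (a + 2 * b * lam) * M"
        by (simp add: algebra_simps)
      also have "\<dots> \<le> lam * M"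
        using lam_ineq M by (rule mult_right_mono)
      finally show ?thesis .
    qed
  qed
qed

definition embed :: "nat \<Rightarrow> (nat \<Rightarrow> 'k) \<Rightarrow> 'k linf" where
  "embed n u = Bcontfun (E n u)"

lemma embed_apply [simp]: "apply_bcontfun (embed n u) = E n u"
proof -
  have "norm (u i) \<le> (\<Sum>i<d n. norm (u i))" if "i < d n" for i
    using that by (intro member_le_sum) auto
  then have "norm (E n u k) \<le> lam * (\<Sum>i<d n. norm (u i))" for k
    by (intro norm_E_le sum_nonneg) auto
  then have "E n u \<in> bcontfun"
    by (intro bcontfun_normI) (auto intro: continuous_on_discrete)
  then show ?thesis
    by (simp add: embed_def Bcontfun_inverse)
qed

text \<open>
  The projections \<open>proj n\<close> have the nested ranges \<open>F n\<close> and kernels given by the vanishing of the first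
  \<open>d n\<close> coordinates; they are bounded by \<open>\<lambda>\<close>. The Bourgain-Delbaen space is the closure of \<open>U\<close>.
\<close>

definition proj :: "nat \<Rightarrow> 'k linf \<Rightarrow> 'k linf" where
  "proj n x = embed n (apply_bcontfun x)"

definition F :: "nat \<Rightarrow> 'k linf set" where
  "F n = range (embed n)"

definition U :: "'k linf set" where
  "U = (\<Union>n. F n)"

lemma proj_apply [simp]: "apply_bcontfun (proj n x) k = E n (apply_bcontfun x) k"
  by (simp add: proj_def)

lemma proj_cong: "(\<And>k. k < d n \<Longrightarrow> apply_bcontfun x k = apply_bcontfun y k) \<Longrightarrow> proj n x = proj n y"
  unfolding proj_def embed_def by (metis E_cong)

lemma proj_mem: "proj n x \<in> F n"
  by (simp add: proj_def F_def)

lemma mem_F_iff: "x \<in> F n \<longleftrightarrow> proj n x = x"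
proof
  assume "x \<in> F n"
  then show "proj n x = x"
    by (auto simp: F_def proj_def intro!: bcontfun_eqI simp: E_E)
qed (metis proj_mem)

lemma proj_proj: "m \<le> n \<Longrightarrow> proj n (proj m x) = proj m x"
  by (auto intro!: bcontfun_eqI simp: proj_def E_E)

lemma F_mono: "m \<le> n \<Longrightarrow> F m \<subseteq> F n"
  by (auto simp: mem_F_iff) (metis proj_proj)

lemma F_subset_U: "F n \<subseteq> U"
  by (auto simp: U_def)

lemma proj_add: "proj n (x + y) = proj n x + proj n y"
  by (rule bcontfun_eqI) (simp add: E_add)

lemma proj_scale: "proj n (scale_linf c x) = scale_linf c (proj n x)"
proof -
  have "apply_bcontfun (scale_linf c x) = (\<lambda>k. c * x k)"
    by (simp add: scale_linf_apply fun_eq_iff)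
  then show ?thesis
    by (intro bcontfun_eqI) (simp add: E_scale scale_linf_apply)
qed

lemma proj_diff: "proj n (x - y) = proj n x - proj n y"
  by (simp add: diff_eq_scale proj_add proj_scale)

lemma proj_eq_0: "(\<And>i. i < d n \<Longrightarrow> apply_bcontfun x i = 0) \<Longrightarrow> proj n x = 0"
  using proj_cong[of n x 0] by (auto intro!: bcontfun_eqI simp: E_zero)

lemma F_add: "x \<in> F n \<Longrightarrow> y \<in> F n \<Longrightarrow> x + y \<in> F n"
  and F_scale: "x \<in> F n \<Longrightarrow> scale_linf c x \<in> F n"
  and F_diff: "x \<in> F n \<Longrightarrow> y \<in> F n \<Longrightarrow> x - y \<in> F n"
  by (simp_all add: mem_F_iff proj_add proj_scale proj_diff)

lemma F_0: "0 \<in> F n"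
  by (simp add: mem_F_iff proj_eq_0)

lemma U_E:
  assumes "x \<in> U"
  obtains n where "n0 \<le> n" "x \<in> F n"
proof -
  obtain m where "x \<in> F m" using assms by (auto simp: U_def)
  then show ?thesis
    using that[of "max n0 m"] F_mono[of m "max n0 m"] by auto
qed

lemma U_scale: "x \<in> U \<Longrightarrow> scale_linf c x \<in> U"
  using F_scale by (auto simp: U_def)

lemma U_add: "x \<in> U \<Longrightarrow> y \<in> U \<Longrightarrow> x + y \<in> U"
proof -
  assume "x \<in> U" "y \<in> U"
  then obtain m where m: "x \<in> F m" by (auto simp: U_def)
  obtain n where "m \<le> n" "y \<in> F n" using \<open>y \<in> U\<close> by (rule U_E)
  then show ?thesis
    using m F_mono[of m n] F_add F_subset_U[of n] by blast
qed

lemma U_diff: "x \<in> U \<Longrightarrow> y \<in> U \<Longrightarrow> x - y \<in> U"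
  by (simp add: diff_eq_scale U_add U_scale)

lemma proj_mem_U: "proj n x \<in> U"
  using proj_mem F_subset_U by blast

lemma U_0: "0 \<in> U"
  using F_0 F_subset_U by blast

lemma U_sum: "(\<And>i. i \<in> A \<Longrightarrow> x i \<in> U) \<Longrightarrow> (\<Sum>i\<in>A. x i) \<in> U"
  by (induction A rule: infinite_finite_induct) (auto simp: U_0 U_add)

lemma norm_proj_le:
  fixes x :: "'k linf"
  assumes "\<And>i. i < d n \<Longrightarrow> norm (x i) \<le> M" "0 \<le> M"
  shows "norm (proj n x) \<le> lam * M"
  by (rule norm_bound) (simp add: norm_E_le assms)

lemma norm_proj_le': "norm (proj n x) \<le> lam * norm x"
  by (intro norm_proj_le norm_bounded) simp

end

section \<open>Upper estimates for blocks, and functionals\<close>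

lemma le_plus_fourth_power:
  fixes r t :: real
  assumes "0 \<le> r" "0 < t"
  shows "r \<le> t + r ^ 4 / t ^ 3"
proof (cases "r \<le> t")
  case True
  then show ?thesis using assms by (simp add: add_increasing2)
next
  case False
  then have "r * t ^ 3 \<le> r * r ^ 3"
    using assms by (intro mult_left_mono power_mono) auto
  then have "r \<le> r ^ 4 / t ^ 3"
    using assms by (simp add: pos_le_divide_eq eval_nat_numeral)
  then show ?thesis using assms by simp
qed

context bd_system
begin

lemma fourth_powers: "a ^ 4 + b ^ 4 < 1"
proof -
  have "0 < a" using b_pos b_less_a by simp
  then have "a * a ^ 3 < 1 * a ^ 3" "b * b ^ 3 < 1 * b ^ 3"
    using a_less_1 b_less_a b_pos by (intro mult_strict_right_mono; simp)+
  then show ?thesis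
    using cubes by (simp add: eval_nat_numeral)
qed

text \<open>
  For successive blocks \<open>x\<^sub>k\<close>, the values at one coordinate \<open>g\<close> are bounded in \<open>l\<^sub>4\<close>, uniformly in \<open>g\<close> and in the
  number of blocks. Let \<open>g\<close> come from \<open>(m, i, j)\<close> at level \<open>n\<close>. A block that ends before \<open>m\<close> has
  \<open>x\<^sub>k g = \<plusminus>a x\<^sub>k i\<close>; a block that lies between \<open>m\<close> and \<open>n\<close> has \<open>x\<^sub>k g = \<plusminus>b x\<^sub>k j\<close>; a block that starts after
  \<open>n\<close> vanishes at \<open>g\<close>. At most one block straddles \<open>m\<close> and at most one straddles \<open>n\<close>. So the best constant
  satisfies \<open>S \<le> (a\<^sup>4 + b\<^sup>4) S + 2 B\<^sup>4\<close>, where \<open>a\<^sup>4 + b\<^sup>4 < a\<^sup>3 + b\<^sup>3 = 1\<close>.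
\<close>

lemma block_fourth_powers:
  fixes x :: "nat \<Rightarrow> 'k linf" and p q :: "nat \<Rightarrow> nat"
  assumes mem: "\<And>k. x k \<in> F (q k)"
    and zero: "\<And>k i. i < d (p k) \<Longrightarrow> x k i = 0"
    and pq: "\<And>k. p k < q k" "\<And>k. q k \<le> p (Suc k)"
    and bound: "\<And>k. norm (x k) \<le> B"
    and fin: "finite A"
  shows "(\<Sum>k\<in>A. norm (x k g) ^ 4) \<le> 2 * B ^ 4 / (1 - a ^ 4 - b ^ 4)"
    (is "?S g \<le> ?C")
proof (induction g rule: less_induct)
  case (less g)
  have C: "0 \<le> ?C" "?C = a ^ 4 * ?C + b ^ 4 * ?C + B ^ 4 + B ^ 4"
    using fourth_powers by (simp_all add: divide_simps) (simp add: algebra_simps)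
  show ?case
  proof (cases "g < d 0")
    case True
    then have "x k g = 0" for k
      using zero[of g k] d_mono[of 0 "p k"] by simp
    then show ?thesis using C by simp
  next
    case False
    then obtain n where n: "d n \<le> g" "g < d (Suc n)"
      using level_exists[of 0 g] by auto
    obtain m i j e' e'' where m: "m < n" "i < d m" "j < d n"
      and sgn: "e' \<in> {1, -1}" "e'' \<in> {1, -1}"
      and eq: "\<And>u. E n u g = e' * of_real a * u i + e'' * of_real b * (u j - E m u j)"
      using coordinate_cases[OF n] by blast
    have ij: "i < g" "j < g"
      using m n d_mono[of m n] by auto
    have ab: "0 < a" "0 < b" using b_pos b_less_a by auto
    have ne: "norm e' = 1" "norm e'' = 1"
      using sgn by auto
    have before: "q k \<le> p l" if "k < l" for k l
      using that
    proof (induction l)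
      case (Suc l)
      then show ?case
        using pq(2)[of l] pq(1)[of l] by (cases "k = l") auto
    qed simp
    have card_straddle: "card {k\<in>A. p k < t \<and> t \<le> q k} \<le> 1" for t
    proof -
      have "k = l" if "p k < t" "t \<le> q k" "p l < t" "t \<le> q l" for k l
        using that before[of k l] before[of l k] by (cases k l rule: linorder_cases) auto
      then show ?thesis
        using fin by (simp add: card_le_Suc0_iff_eq)
    qed
    let ?W = "\<lambda>t. {k\<in>A. p k < t \<and> t \<le> q k}"
    have B4: "norm (x k g) ^ 4 \<le> B ^ 4" for k
      using bound[of k] norm_bounded[of "x k" g] by (intro power_mono) auto
    have B0: "0 \<le> B" using bound[of 0] norm_ge_zero[of "x 0"] by linarith
    have "norm (x k g) ^ 4 \<le> a ^ 4 * norm (x k i) ^ 4 + b ^ 4 * norm (x k j) ^ 4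
        + (if k \<in> ?W m then B ^ 4 else 0) + (if k \<in> ?W (Suc n) then B ^ 4 else 0)"
      (is "?l \<le> ?r") if "k \<in> A" for k
    proof -
      consider "q k \<le> m" | "m \<le> p k" "q k \<le> n" | "n < p k"
        | "k \<in> ?W m" | "k \<in> ?W (Suc n)"
        using \<open>k \<in> A\<close> pq(1)[of k] by force
      then show ?thesis
      proof cases
        case 1
        then have x: "x k \<in> F m" "x k \<in> F n"
          using mem[of k] F_mono[of "q k" m] F_mono[of "q k" n] m by auto
        have "x k g = e' * of_real a * x k i"
          using eq[of "x k"] x unfolding mem_F_iff proj_apply[symmetric] by simp
        then have "norm (x k g) ^ 4 = a ^ 4 * norm (x k i) ^ 4"
          using ab by (simp add: norm_mult ne power_mult_distrib)
        then show ?thesis using B0 ab by simp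
      next
        case 2
        have x: "x k \<in> F n"
          using 2 mem[of k] F_mono[of "q k" n] by auto
        have z: "x k t = 0" if "t < d m" for t
          using that zero[of t k] d_mono[OF 2(1)] by simp
        then have "proj m (x k) = 0" by (rule proj_eq_0)
        then have "x k g = e'' * of_real b * x k j"
          using eq[of "x k"] x z[OF m(2)] unfolding mem_F_iff proj_apply[symmetric] by simp
        then have "norm (x k g) ^ 4 = b ^ 4 * norm (x k j) ^ 4"
          using ab by (simp add: norm_mult ne power_mult_distrib)
        then show ?thesis using B0 ab by simp
      next
        case 3
        then have "x k g = 0"
          using zero[of g k] n d_mono[of "Suc n" "p k"] by simp
        then show ?thesis using B0 ab by simp
      next
        case 4
        have "0 \<le> a ^ 4 * norm (x k i) ^ 4" "0 \<le> b ^ 4 * norm (x k j) ^ 4"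
          using ab by simp_all
        moreover have "(if k \<in> ?W m then B ^ 4 else 0) = B ^ 4"
          using 4 by (rule if_P)
        moreover have "0 \<le> (if k \<in> ?W (Suc n) then B ^ 4 else 0)"
          using B0 by simp
        ultimately show ?thesis using B4[of k] by linarith
      next
        case 5
        have "0 \<le> a ^ 4 * norm (x k i) ^ 4" "0 \<le> b ^ 4 * norm (x k j) ^ 4"
          using ab by simp_all
        moreover have "(if k \<in> ?W (Suc n) then B ^ 4 else 0) = B ^ 4"
          using 5 by (rule if_P)
        moreover have "0 \<le> (if k \<in> ?W m then B ^ 4 else 0)"
          using B0 by simp
        ultimately show ?thesis using B4[of k] by linarith
      qed
    qed
    then have "?S g \<le> (\<Sum>k\<in>A. a ^ 4 * norm (x k i) ^ 4 + b ^ 4 * norm (x k j) ^ 4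
        + (if k \<in> ?W m then B ^ 4 else 0) + (if k \<in> ?W (Suc n) then B ^ 4 else 0))"
      by (rule sum_mono)
    also have "\<dots> = a ^ 4 * ?S i + b ^ 4 * ?S j
        + real (card (?W m)) * B ^ 4 + real (card (?W (Suc n))) * B ^ 4"
      using fin by (simp add: sum.distrib sum_distrib_left sum.If_cases Int_def del: mem_Collect_eq) (simp add: conj_ac)
    also have "\<dots> \<le> a ^ 4 * ?C + b ^ 4 * ?C + 1 * B ^ 4 + 1 * B ^ 4"
      using card_straddle[of m] card_straddle[of "Suc n"] B0 ab
      by (intro add_mono mult_left_mono mult_right_mono less.IH ij) auto
    also have "\<dots> = ?C" using C(2) by linarith
    finally show ?thesis .
  qed
qed

text \<open>
  The \<open>l\<^sub>4\<close> bound enters in the weak form that block sums have norm \<open>o(K)\<close>: the parameter \<open>t\<close> may be chosen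
  arbitrarily small, and the second summand does not depend on \<open>K\<close>.
\<close>

lemma norm_block_sum_le:
  fixes x :: "nat \<Rightarrow> 'k linf" and p q :: "nat \<Rightarrow> nat"
  assumes mem: "\<And>k. x k \<in> F (q k)"
    and zero: "\<And>k i. i < d (p k) \<Longrightarrow> x k i = 0"
    and pq: "\<And>k. p k < q k" "\<And>k. q k \<le> p (Suc k)"
    and bound: "\<And>k. norm (x k) \<le> B"
    and t: "0 < t"
  shows "norm (\<Sum>k<K. x k) \<le> real K * t + 2 * B ^ 4 / (1 - a ^ 4 - b ^ 4) / t ^ 3"
proof (rule norm_bound)
  fix g
  have "apply_bcontfun (\<Sum>k<K. x k) g = (\<Sum>k<K. x k g)"
    by (induction K) simp_all
  then have "norm ((\<Sum>k<K. x k) g) \<le> (\<Sum>k<K. norm (x k g))"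
    by (simp add: norm_sum)
  also have "\<dots> \<le> (\<Sum>k<K. t + norm (x k g) ^ 4 / t ^ 3)"
    by (intro sum_mono le_plus_fourth_power t) simp
  also have "\<dots> = real K * t + (\<Sum>k<K. norm (x k g) ^ 4) / t ^ 3"
    by (simp add: sum.distrib sum_divide_distrib)
  also have "\<dots> \<le> real K * t + 2 * B ^ 4 / (1 - a ^ 4 - b ^ 4) / t ^ 3"
    using t by (intro add_left_mono divide_right_mono
        block_fourth_powers[where p = p and q = q] mem zero pq bound) auto
  finally show "norm ((\<Sum>k<K. x k) g) \<le> \<dots>" .
qed

text \<open>
  The functionals \<open>f \<circ> P\<^sub>n\<close> converge to \<open>f\<close> in norm, that is, the decomposition is shrinking. Otherwise
  there would be successive blocks \<open>x\<^sub>k\<close> of bounded norm, each normalised by a unimodular factor, with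
  \<open>f x\<^sub>k \<ge> e\<close>. Then \<open>f\<close> would grow linearly on the sums of the first \<open>K\<close> blocks,
  whereas their norms are \<open>o(K)\<close> by \<open>norm_block_sum_le\<close>.
\<close>

lemma functional_tail:
  fixes f :: "'k linf \<Rightarrow> 'k"
  assumes add: "\<And>x y. x \<in> U \<Longrightarrow> y \<in> U \<Longrightarrow> f (x + y) = f x + f y"
    and scale: "\<And>c x. x \<in> U \<Longrightarrow> f (scale_linf c x) = c * f x"
    and bound: "\<And>x. x \<in> U \<Longrightarrow> norm (f x) \<le> C * norm x"
    and e: "0 < e"
  shows "\<exists>N. \<forall>n\<ge>N. \<forall>x\<in>U. norm (f (x - proj n x)) \<le> e * norm x"
proof (rule ccontr)
  assume "\<not> ?thesis"
  then have bad: "\<forall>N. \<exists>n\<ge>N. \<exists>x\<in>U. e * norm x < norm (f (x - proj n x))"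
    by (meson not_le)
  have f0: "f 0 = 0" using add[OF U_0 U_0] by simp
  have "\<exists>p q y r. N \<le> p \<and> p < q \<and> y \<in> F q \<and> (\<forall>i<d p. y i = 0) \<and>
      norm y \<le> 1 + lam \<and> e \<le> r \<and> f y = of_real r" for N
  proof -
    obtain n x where n: "N \<le> n" and x: "x \<in> U" and big: "e * norm x < norm (f (x - proj n x))"
      using bad by blast
    let ?z = "x - proj n x"
    have nx: "0 < norm x"
      using big f0 by (cases "x = 0") (auto simp: proj_eq_0)
    obtain \<theta> where \<theta>: "norm \<theta> = 1" "\<theta> * f ?z = of_real (norm (f ?z))"
      using unimodular_real by blast
    obtain q where q: "Suc n \<le> q" "x \<in> F q" using x by (rule U_E)
    have zF: "?z \<in> F q"
      using q F_mono[of n q] proj_mem[of n x] by (intro F_diff) auto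
    let ?y = "scale_linf (of_real (1 / norm x) * \<theta>) ?z"
    have "norm ?y \<le> norm (of_real (1 / norm x) * \<theta>) * norm ?z"
      by (rule norm_scale_linf)
    also have "\<dots> \<le> (1 / norm x) * (norm x + lam * norm x)"
      using norm_triangle_ineq4[of x "proj n x"] norm_proj_le'[of n x]
      by (simp add: norm_mult \<theta> norm_divide divide_right_mono)
    also have "\<dots> = 1 + lam"
      using nx by (simp add: field_simps)
    finally have 1: "norm ?y \<le> 1 + lam" .
    have 2: "f ?y = of_real (norm (f ?z) / norm x)"
      using zF F_subset_U[of q] \<theta> by (subst scale) (auto simp: mult.assoc)
    have 3: "e \<le> norm (f ?z) / norm x"
      using big nx by (simp add: field_simps)
    have 4: "?y i = 0" if "i < d n" for i
      using that by (simp add: scale_linf_apply E_extends)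
    show ?thesis
      using n q(1) F_scale[OF zF] 1 2 3 4 by (metis Suc_le_lessD)
  qed
  then obtain p q :: "nat \<Rightarrow> nat" and y r where
    P: "\<And>N. N \<le> p N" "\<And>N. p N < q N" "\<And>N. y N \<in> F (q N)" "\<And>N i. i < d (p N) \<Longrightarrow> y N i = 0"
      "\<And>N. norm (y N) \<le> 1 + lam" "\<And>N. e \<le> r N" "\<And>N. f (y N) = of_real (r N)"
    by metis
  \<comment> \<open>Chaining the blocks: the block chosen beyond \<open>N\<close> ends at \<open>q N\<close>, where the next choice starts.\<close>
  define s where "s k = (q ^^ k) 0" for k
  let ?C = "\<bar>C\<bar> + 1"
  define t where "t = e / (2 * ?C)"
  define D where "D = 2 * (1 + lam) ^ 4 / (1 - a ^ 4 - b ^ 4) / t ^ 3"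
  have t: "0 < t" using e by (simp add: t_def)
  have le: "real K * e \<le> ?C * (real K * t + D)" for K
  proof -
    let ?x = "\<Sum>k<K. y (s k)"
    have yU: "y N \<in> U" for N
      using P(3) F_subset_U by blast
    have fx: "f (\<Sum>k<K. y (s k)) = of_real (\<Sum>k<K. r (s k))" for K
      by (induction K) (auto simp: f0 add U_sum yU P(7))
    have "real K * e \<le> (\<Sum>k<K. r (s k))"
      using sum_mono[of "{..<K}" "\<lambda>_. e" "\<lambda>k. r (s k)"] P(6) by simp
    also have "\<dots> \<le> norm (f ?x)"
      unfolding fx norm_of_real by simp
    also have "\<dots> \<le> C * norm ?x"
      by (intro bound U_sum yU)
    also have "\<dots> \<le> ?C * norm ?x"
      by (intro mult_right_mono) auto
    also have "norm ?x \<le> real K * t + D"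
      unfolding D_def
      by (rule norm_block_sum_le[of _ "\<lambda>k. q (s k)" "\<lambda>k. p (s k)"])
         (auto simp: P t s_def)
    finally show ?thesis by (simp add: mult_left_mono)
  qed
  obtain K :: nat where "2 * (?C * D) / e < real K"
    using reals_Archimedean2 by blast
  then have "?C * D < real K * e / 2"
    using e by (simp add: field_simps)
  moreover have "?C * (real K * t) = real K * e / 2"
    by (simp add: t_def field_simps)
  ultimately show False
    using le[of K] unfolding distrib_left by linarith
qed

end

section \<open>Operators into the Hilbert space\<close>

context bd_system
begin

lemma E_sum: "E n (\<lambda>k. \<Sum>i\<in>A. f i k) k = (\<Sum>i\<in>A. E n (f i) k)"
  by (induction A rule: infinite_finite_induct) (simp_all add: E_zero E_add)

lemma F_basis:
  assumes "x \<in> F n"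
  shows "x = (\<Sum>i<d n. scale_linf (x i) (embed n (\<lambda>k. if k = i then 1 else 0)))"
proof (rule bcontfun_eqI)
  fix k
  have "E n (apply_bcontfun x) = E n (\<lambda>k. \<Sum>i<d n. x i * (if k = i then 1 else 0))"
  proof (rule E_cong)
    fix k assume "k < d n"
    have "(\<Sum>i<d n. x i * (if k = i then 1 else 0)) = (\<Sum>i<d n. if k = i then x i else 0)"
      by (intro sum.cong) auto
    then show "x k = (\<Sum>i<d n. x i * (if k = i then 1 else 0))"
      using \<open>k < d n\<close> by simp
  qed
  then have "E n (apply_bcontfun x) k = (\<Sum>i<d n. x i * E n (\<lambda>k. if k = i then 1 else 0) k)"
    by (simp add: E_sum E_scale)
  moreover have "x k = E n (apply_bcontfun x) k"
    using assms by (metis mem_F_iff proj_apply)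
  ultimately show "x k = (\<Sum>i<d n. scale_linf (x i) (embed n (\<lambda>k. if k = i then 1 else 0))) k"
    by (simp add: sum_linf_apply scale_linf_apply)
qed

context
  fixes T :: "'k linf \<Rightarrow> 'k ell2" and C :: real
  assumes T_add: "\<And>x y. x \<in> U \<Longrightarrow> y \<in> U \<Longrightarrow> T (x + y) = T x + T y"
    and T_scale: "\<And>c x. x \<in> U \<Longrightarrow> T (scale_linf c x) = scale_ell2 c (T x)"
    and T_bound: "\<And>x. x \<in> U \<Longrightarrow> norm (T x) \<le> C * norm x"
begin

lemma T_diff: "x \<in> U \<Longrightarrow> y \<in> U \<Longrightarrow> T (x - y) = T x - T y"
  by (simp add: diff_eq_scale T_add T_scale U_scale) (auto intro: ell2_eqI)

lemma T_0: "T 0 = 0"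
  using T_add[OF U_0 U_0] by simp

lemma T_sum: "(\<And>i. i \<in> A \<Longrightarrow> x i \<in> U) \<Longrightarrow> T (\<Sum>i\<in>A. x i) = (\<Sum>i\<in>A. T (x i))"
  by (induction A rule: infinite_finite_induct) (simp_all add: T_0 T_add U_sum)

text \<open>
  The restriction of \<open>T\<close> to a finite-dimensional subspace is compact.
\<close>

lemma tail_small_on_F:
  assumes "0 < e"
  shows "\<exists>m\<ge>m0. \<forall>x\<in>F n. norm (tail_ell2 m (T x)) \<le> e * norm x"
proof -
  define v where "v i = embed n (\<lambda>k. if k = i then 1 else 0)" for i :: nat
  have vU: "v i \<in> U" for i
    using F_subset_U[of n] by (auto simp: v_def F_def)
  have "(\<lambda>m. \<Sum>i<d n. norm (tail_ell2 m (T (v i)))) \<longlonglongrightarrow> (\<Sum>i<d n. 0)"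
    by (intro tendsto_sum tail_ell2_tendsto_0)
  then have "\<forall>\<^sub>F m in sequentially. (\<Sum>i<d n. norm (tail_ell2 m (T (v i)))) < e"
    using assms by (simp add: order_tendsto_iff)
  then have "\<forall>\<^sub>F m in sequentially. (\<Sum>i<d n. norm (tail_ell2 m (T (v i)))) < e \<and> m0 \<le> m"
    using eventually_ge_at_top by (rule eventually_conj)
  then obtain m where m: "(\<Sum>i<d n. norm (tail_ell2 m (T (v i)))) < e" "m0 \<le> m"
    unfolding eventually_sequentially by blast
  have "norm (tail_ell2 m (T x)) \<le> e * norm x" if x: "x \<in> F n" for x
  proof -
    have "T x = (\<Sum>i<d n. scale_ell2 (x i) (T (v i)))"
      by (subst F_basis[OF x]) (simp add: v_def[symmetric] T_sum U_scale vU T_scale)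
    then have "norm (tail_ell2 m (T x)) \<le> (\<Sum>i<d n. norm (x i) * norm (tail_ell2 m (T (v i))))"
      by (simp add: tail_ell2_sum tail_ell2_scale sum_norm_le norm_scale_ell2)
    also have "\<dots> \<le> (\<Sum>i<d n. norm x * norm (tail_ell2 m (T (v i))))"
      by (intro sum_mono mult_right_mono norm_bounded) auto
    also have "\<dots> = (\<Sum>i<d n. norm (tail_ell2 m (T (v i)))) * norm x"
      by (simp add: sum_distrib_left mult.commute)
    also have "\<dots> \<le> e * norm x"
      using m by (intro mult_right_mono) auto
    finally show ?thesis .
  qed
  then show ?thesis using m(2) by blast
qed

text \<open>
  This is \<open>functional_tail\<close> for the finitely many coordinate functionals of \<open>head_ell2 m \<circ> T\<close>.
\<close>

lemma head_small_off_F: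
  assumes e: "0 < e"
  shows "\<exists>n\<ge>n0. \<forall>x\<in>U. norm (head_ell2 m (T (x - proj n x))) \<le> e * norm x"
proof -
  have "\<forall>\<^sub>F n in sequentially. \<forall>x\<in>U. norm (ell2_nth (T (x - proj n x)) i) \<le> e / (m + 1) * norm x" for i
  proof -
    have "norm (ell2_nth (T x) i) \<le> C * norm x" if "x \<in> U" for x
      using norm_ell2_nth_le T_bound[OF that] by (rule order_trans)
    then show ?thesis
      unfolding eventually_sequentially
      using e by (intro functional_tail[of "\<lambda>x. ell2_nth (T x) i" C]) (auto simp: T_add T_scale)
  qed
  then have "\<forall>\<^sub>F n in sequentially. \<forall>i\<in>{..<m}. \<forall>x\<in>U. norm (ell2_nth (T (x - proj n x)) i) \<le> e / (m + 1) * norm x"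
    by (intro eventually_ball_finite) auto
  then have "\<forall>\<^sub>F n in sequentially. (\<forall>i\<in>{..<m}. \<forall>x\<in>U. norm (ell2_nth (T (x - proj n x)) i) \<le> e / (m + 1) * norm x) \<and> n0 \<le> n"
    using eventually_ge_at_top by (rule eventually_conj)
  then obtain n where n: "\<And>i x. i < m \<Longrightarrow> x \<in> U \<Longrightarrow> norm (ell2_nth (T (x - proj n x)) i) \<le> e / (m + 1) * norm x"
    and "n0 \<le> n"
    unfolding eventually_sequentially by blast
  have "norm (head_ell2 m (T (x - proj n x))) \<le> e * norm x" if "x \<in> U" for x
  proof -
    have "norm (head_ell2 m (T (x - proj n x))) \<le> (\<Sum>i<m. e / (m + 1) * norm x)"
      using norm_head_ell2_le_sum n[OF _ that] by (intro order_trans[OF norm_head_ell2_le_sum] sum_mono) auto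
    also have "\<dots> = (real m / (m + 1)) * (e * norm x)" by simp
    also have "\<dots> \<le> 1 * (e * norm x)"
      using e by (intro mult_right_mono) auto
    finally show ?thesis by simp
  qed
  then show ?thesis using \<open>n0 \<le> n\<close> by blast
qed

text \<open>
  Assume that \<open>T\<close> does not become small on composition with \<open>tail_ell2 m\<close>. The vector \<open>u\<close> collects \<open>K\<close>
  humps of \<open>T\<close> in disjoint ranges of coordinates of the target, while its norm stays bounded: only the
  first \<open>d n\<close> entries of \<open>u\<close> matter, different steps fill disjoint sets of entries, and so these entries are
  bounded by \<open>1 + \<lambda>\<close> for every \<open>K\<close>.

  The statement quantifies over all \<open>w\<close> that agree with \<open>u\<close> on the first \<open>d n\<close> entries, because the
  next step replaces \<open>u\<close> by a vector with these entries that no longer lies in \<open>F n\<close>. Such a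
  replacement alters the humps already found only slightly by \<open>head_small_off_F\<close>. It also feeds an
  uncontrolled vector \<open>v\<close> into the range of the new hump, which is why the sign of the new entries is chosen
  so that the contribution of \<open>v\<close> does not cancel that of the new block.
\<close>

lemma gliding_hump:
  assumes e: "0 < e"
    and bad: "\<And>m. \<exists>x\<in>U. e * norm x < norm (tail_ell2 m (T x))"
  shows "\<exists>m (u :: 'k linf) n. u \<in> F n \<and> (\<forall>i<d n. norm (u i) \<le> 1 + lam) \<and>
    (\<forall>w\<in>U. (\<forall>i<d n. apply_bcontfun w i = u i) \<longrightarrow> norm w \<le> lam * (1 + lam) \<longrightarrow>
      real K * (e / 4)\<^sup>2 \<le> (norm (head_ell2 m (T w)))\<^sup>2)"
proof (induction K)
  case 0
  show ?case
    using F_0 lam_gt_1 by (intro exI[of _ 0] exI[of _ "0::'k linf"]) auto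
next
  case (Suc K)
  let ?B = "1 + lam"
  have B: "0 < ?B" "0 < lam" using lam_gt_1 by auto
  from Suc obtain m n and u :: "'k linf" where u: "u \<in> F n" "\<And>i. i < d n \<Longrightarrow> norm (u i) \<le> ?B"
    and IH: "\<And>w. w \<in> U \<Longrightarrow> (\<And>i. i < d n \<Longrightarrow> apply_bcontfun w i = u i) \<Longrightarrow> norm w \<le> lam * ?B \<Longrightarrow>
      real K * (e / 4)\<^sup>2 \<le> (norm (head_ell2 m (T w)))\<^sup>2"
    by blast
  obtain m1 where m1: "m \<le> m1" "\<And>y. y \<in> F n \<Longrightarrow> norm (tail_ell2 m1 (T y)) \<le> e / (2 * lam) * norm y"
    using tail_small_on_F[of "e / (2 * lam)" m n] e B by auto
  obtain z where z: "z \<in> U" "e * norm z < norm (tail_ell2 m1 (T z))"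
    using bad by blast
  have nz: "0 < norm z"
    using z norm_tail_ell2_le[of m1 "T z"] by (cases "z = 0") (auto simp: T_0)
  define x0 where "x0 = scale_linf (of_real (1 / norm z)) z"
  have "norm x0 \<le> norm (of_real (1 / norm z) :: 'k) * norm z"
    unfolding x0_def by (rule norm_scale_linf)
  then have x0: "x0 \<in> U" "norm x0 \<le> 1"
    using nz z by (auto simp: x0_def U_scale norm_divide)
  have "norm (tail_ell2 m1 (T x0)) = norm (tail_ell2 m1 (T z)) / norm z"
    using z by (simp add: x0_def T_scale tail_ell2_scale norm_scale_ell2 norm_divide)
  then have x0_big: "e < norm (tail_ell2 m1 (T x0))"
    using z nz by (simp add: pos_less_divide_eq)
  obtain n1 where n1: "n \<le> n1" "x0 \<in> F n1"
    using x0(1) by (rule U_E)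
  \<comment> \<open>Removing the first \<open>d n\<close> entries costs at most \<open>e / 2\<close> beyond \<open>m1\<close>, by the choice of \<open>m1\<close>.\<close>
  define x where "x = x0 - proj n x0"
  have "lam * norm x0 \<le> lam * 1"
    using x0(2) B by (intro mult_left_mono) auto
  then have px: "norm (proj n x0) \<le> lam"
    using norm_proj_le'[of n x0] by linarith
  have x: "x \<in> F n1" "norm x \<le> ?B" "\<And>i. i < d n \<Longrightarrow> x i = 0"
    using n1 F_mono[of n n1] proj_mem[of n x0] px x0(2) norm_triangle_ineq4[of x0 "proj n x0"]
    by (auto simp: x_def E_extends intro!: F_diff)
  have "norm (tail_ell2 m1 (T (proj n x0))) \<le> e / (2 * lam) * norm (proj n x0)"
    by (rule m1(2)) (rule proj_mem)
  also have "\<dots> \<le> e / (2 * lam) * lam"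
    using px e B by (intro mult_left_mono) auto
  finally have "norm (tail_ell2 m1 (T (proj n x0))) \<le> e / 2"
    using B by simp
  moreover have "tail_ell2 m1 (T x) = tail_ell2 m1 (T x0) - tail_ell2 m1 (T (proj n x0))"
    by (simp add: x_def T_diff x0 proj_mem_U tail_ell2_minus)
  ultimately have x_big: "e / 2 < norm (tail_ell2 m1 (T x))"
    using x0_big norm_triangle_ineq2[of "tail_ell2 m1 (T x0)" "tail_ell2 m1 (T (proj n x0))"]
    by simp
  obtain m2 where m2: "m1 \<le> m2"
    "norm (tail_ell2 m2 (tail_ell2 m1 (T x))) < norm (tail_ell2 m1 (T x)) - e / 2"
    using norm_tail_ell2_small[of "norm (tail_ell2 m1 (T x)) - e / 2" m1] x_big by auto
  define S where "S w = head_ell2 m2 (tail_ell2 m1 (T w))" for w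
  have S_big: "e / 2 < norm (S x)"
    using m2(2) norm_triangle_ineq2[of "tail_ell2 m1 (T x)" "tail_ell2 m2 (tail_ell2 m1 (T x))"]
    by (simp add: S_def tail_ell2_def[of m2])
  have S_add: "S (w + w') = S w + S w'" and S_diff: "S (w - w') = S w - S w'"
    if "w \<in> U" "w' \<in> U" for w w'
    using that by (simp_all add: S_def T_add T_diff tail_ell2_add tail_ell2_minus head_ell2_add head_ell2_minus)
  obtain n2 where n2: "n1 \<le> n2"
    "\<And>w. w \<in> U \<Longrightarrow> norm (head_ell2 m2 (T (w - proj n2 w))) \<le> e / (4 * (lam * ?B)) * norm w"
    using head_small_off_F[of "e / (4 * (lam * ?B))" n1 m2] e B by auto
  define v where "v = embed n2 (\<lambda>k. if k < d n then u k else 0)"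
  have v: "v \<in> F n2" "\<And>i. i < d n2 \<Longrightarrow> v i = (if i < d n then u i else 0)"
    by (simp_all add: v_def F_def E_extends)
  have x2: "x \<in> F n2" using x(1) F_mono[OF n2(1)] by blast
  have U: "v \<in> U" "x \<in> U" using v x2 F_subset_U by blast+
  \<comment> \<open>The sign: \<open>S (v + x)\<close> and \<open>S (v - x)\<close> differ by \<open>2 S x\<close>, so one of them is at least as large as \<open>S x\<close>.\<close>
  have "\<exists>y :: 'k linf. y \<in> F n2 \<and> (\<forall>i. norm (y i) = norm (x i)) \<and> norm (S x) \<le> norm (S (v + y))"
  proof (cases "norm (S x) \<le> norm (S (v + x))")
    case True
    then show ?thesis using x2 by blast
  next
    case False
    have "2 *\<^sub>R S x = S (v + x) - S (v - x)"
      using U by (simp add: S_add S_diff scaleR_2)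
    then have "2 * norm (S x) \<le> norm (S (v + x)) + norm (S (v - x))"
      using norm_triangle_ineq4[of "S (v + x)" "S (v - x)"] by (metis abs_numeral norm_scaleR)
    then have "norm (S x) \<le> norm (S (v + - x))"
      using False by simp
    moreover have "- x \<in> F n2"
      using F_diff[OF F_0 x2] by simp
    ultimately show ?thesis by (intro exI[of _ "- x"]) simp
  qed
  then obtain y :: "'k linf" where y: "y \<in> F n2" "\<And>i. norm (y i) = norm (x i)" "norm (S x) \<le> norm (S (v + y))"
    by blast
  define u' where "u' = v + y"
  have dn: "d n \<le> d n2" using n1(1) n2(1) by (intro d_mono) simp
  have y0: "y i = 0" if "i < d n" for i
    using y(2)[of i] x(3)[OF that] by simp
  have u'F: "u' \<in> F n2" using v y by (simp add: u'_def F_add)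
  have u'_low: "u' i = u i" if "i < d n" for i
    using that v(2)[of i] dn y0 by (simp add: u'_def)
  have u'_bound: "norm (u' i) \<le> ?B" if "i < d n2" for i
  proof (cases "i < d n")
    case True
    then show ?thesis using u'_low u(2) by simp
  next
    case False
    then have "norm (u' i) = norm (x i)"
      using v(2)[OF that] y(2)[of i] by (simp add: u'_def)
    then show ?thesis using x(2) norm_bounded[of x i] by simp
  qed
  have "real (Suc K) * (e / 4)\<^sup>2 \<le> (norm (head_ell2 m2 (T w)))\<^sup>2"
    if w: "w \<in> U" "\<And>i. i < d n2 \<Longrightarrow> apply_bcontfun w i = u' i" "norm w \<le> lam * ?B" for w
  proof -
    have "proj n2 w = proj n2 u'"
      using w(2) by (rule proj_cong)
    then have pw: "proj n2 w = u'"
      using u'F by (simp add: mem_F_iff)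
    have "norm (S (w - u')) \<le> norm (head_ell2 m2 (T (w - u')))"
      unfolding S_def by (rule norm_ell2_le_of_nth) simp
    also have "\<dots> \<le> e / (4 * (lam * ?B)) * norm w"
      using n2(2)[OF w(1)] by (simp add: pw)
    also have "\<dots> \<le> e / (4 * (lam * ?B)) * (lam * ?B)"
      using w(3) e B by (intro mult_left_mono) auto
    also have "\<dots> = e / 4" using B by simp
    finally have "norm (S (w - u')) \<le> e / 4" .
    moreover have "S (w - u') = S w - S u'"
      using w(1) u'F F_subset_U by (intro S_diff) auto
    ultimately have "norm (S w - S u') \<le> e / 4"
      by (simp only:)
    then have "e / 4 \<le> norm (S w)"
      using norm_triangle_ineq3[of "S w" "S u'"] S_big y(3) unfolding u'_def[symmetric] by linarith
    then have "(e / 4)\<^sup>2 \<le> (norm (S w))\<^sup>2"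
      using e by (intro power_mono) auto
    moreover have "real K * (e / 4)\<^sup>2 \<le> (norm (head_ell2 m (T w)))\<^sup>2"
      using w u'_low dn by (intro IH) auto
    moreover have "(norm (head_ell2 m (T w)))\<^sup>2 + (norm (S w))\<^sup>2 \<le> (norm (head_ell2 m2 (T w)))\<^sup>2"
      unfolding S_def norm_head_tail_ell2_sq unfolding norm_head_ell2_sq
      using m1(1) m2(1)
      by (subst sum.union_disjoint[symmetric]) (auto intro!: sum_mono2)
    ultimately show ?thesis
      by (simp add: distrib_right)
  qed
  then show ?case
    using u'F u'_bound by blast
qed

text \<open>
  With \<open>K\<close> humps the image of a vector of norm at most \<open>\<lambda> (1 + \<lambda>)\<close> has norm at least \<open>\<surd>K e / 4\<close>.
\<close>

lemma tail_of_image_small: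
  assumes e: "0 < e"
  shows "\<exists>m. \<forall>x\<in>U. norm (tail_ell2 m (T x)) \<le> e * norm x"
proof (rule ccontr)
  assume "\<not> ?thesis"
  then have bad: "\<exists>x\<in>U. e * norm x < norm (tail_ell2 m (T x))" for m
    by (meson not_le)
  let ?M = "lam * (1 + lam)"
  obtain K :: nat where K: "(C * ?M)\<^sup>2 / (e / 4)\<^sup>2 < real K"
    using reals_Archimedean2 by blast
  obtain m n and u :: "'k linf" where u: "u \<in> F n" "\<And>i. i < d n \<Longrightarrow> norm (u i) \<le> 1 + lam"
    and big: "\<And>w. w \<in> U \<Longrightarrow> (\<And>i. i < d n \<Longrightarrow> apply_bcontfun w i = u i) \<Longrightarrow> norm w \<le> ?M \<Longrightarrow>
      real K * (e / 4)\<^sup>2 \<le> (norm (head_ell2 m (T w)))\<^sup>2"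
    using gliding_hump[OF e bad, of K] by blast
  have uU: "u \<in> U" using u F_subset_U by blast
  have nu: "norm u \<le> ?M"
    using norm_proj_le[of n u "1 + lam"] u lam_gt_1 by (simp add: mem_F_iff)
  have "norm (head_ell2 m (T u)) \<le> C * norm u"
    using norm_head_ell2_le T_bound[OF uU] by (rule order_trans)
  also have "\<dots> \<le> \<bar>C\<bar> * ?M"
    using nu by (intro mult_mono) auto
  finally have "(norm (head_ell2 m (T u)))\<^sup>2 \<le> (\<bar>C\<bar> * ?M)\<^sup>2"
    by (rule power_mono) simp
  then have "real K * (e / 4)\<^sup>2 \<le> (C * ?M)\<^sup>2"
    using big[OF uU refl nu] by (simp add: power_mult_distrib)
  then show False
    using K e by (simp add: pos_divide_less_eq)
qed

end

lemma closure_U_diff: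
  assumes "x \<in> closure U" "z \<in> U"
  shows "x - z \<in> closure U"
proof -
  have "(\<lambda>x. x - z) ` closure U \<subseteq> closure U"
    using assms(2) U_diff closure_subset[of U]
    by (intro image_closure_subset continuous_intros) auto
  then show ?thesis using assms(1) by blast
qed

lemma operator_to_ell2_compact:
  fixes T :: "'k linf \<Rightarrow> 'k ell2"
  assumes "bounded_operator scale_linf scale_ell2 (closure U) UNIV T"
  shows "compact_operator (closure U) UNIV T"
proof (rule compact_operatorI)
  show "complete (UNIV :: 'k ell2 set)" by (rule complete_UNIV)
  obtain C where add: "\<And>x y. x \<in> closure U \<Longrightarrow> y \<in> closure U \<Longrightarrow> T (x + y) = T x + T y"
    and scale: "\<And>c x. x \<in> closure U \<Longrightarrow> T (scale_linf c x) = scale_ell2 c (T x)"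
    and bound: "\<And>x. x \<in> closure U \<Longrightarrow> norm (T x) \<le> C * norm x"
    using assms unfolding bounded_operator_def by blast
  have UX: "x \<in> closure U" if "x \<in> U" for x
    using that closure_subset by blast
  fix e :: real assume e: "0 < e"
  define c where "c = \<bar>C\<bar> + 1"
  have c: "0 < c" "C \<le> c" by (simp_all add: c_def)
  have bound': "norm (T x) \<le> c * norm x" if "x \<in> closure U" for x
    by (rule order_trans[OF bound[OF that] mult_right_mono]) (simp_all add: c)
  obtain m where m: "\<And>x. x \<in> U \<Longrightarrow> norm (tail_ell2 m (T x)) \<le> e / 4 * norm x"
    using tail_of_image_small[of T C "e / 4"] add scale bound UX e by (metis divide_pos_pos zero_less_numeral)
  obtain K where K: "compact K"
    "\<And>t. (\<And>i. norm (t i) \<le> c) \<Longrightarrow> (\<Sum>i<m. scale_ell2 (t i) (unit_ell2 i :: 'k ell2)) \<in> K"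
    using compact_linear_combinations[of "scale_ell2 :: 'k \<Rightarrow> _" c unit_ell2 m]
    by (auto simp: norm_scale_ell2 scale_ell2_diff)
  have "\<exists>y\<in>K. dist (T x) y < e" if x: "x \<in> closure U" "norm x \<le> 1" for x
  proof
    define \<delta> where "\<delta> = min 1 (e / (4 * c))"
    have "c * \<delta> \<le> c * (e / (4 * c))"
      using c by (intro mult_left_mono) (simp_all add: \<delta>_def)
    also have "\<dots> = e / 4" using c by simp
    finally have d: "0 < \<delta>" "\<delta> \<le> 1" "c * \<delta> \<le> e / 4"
      using e c by (simp_all add: \<delta>_def)
    obtain z where z: "z \<in> U" "dist z x < \<delta>"
      using x(1) d(1) closure_approachable[of x U] by blast
    have "T x = T z + T (x - z)"
      using add[OF UX[OF z(1)] closure_U_diff[OF x(1) z(1)]] by simp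
    then have "norm (tail_ell2 m (T x)) \<le> norm (tail_ell2 m (T z)) + norm (tail_ell2 m (T (x - z)))"
      by (simp add: tail_ell2_add norm_triangle_ineq)
    also have "norm (tail_ell2 m (T (x - z))) \<le> c * norm (x - z)"
      using norm_tail_ell2_le bound'[OF closure_U_diff[OF x(1) z(1)]] by (rule order_trans)
    also have "\<dots> \<le> c * \<delta>"
      using z(2) c by (intro mult_left_mono) (auto simp: dist_norm norm_minus_commute)
    also have "norm z \<le> 2"
      using z(2) d(2) x(2) norm_triangle_ineq3[of z x] by (simp add: dist_norm)
    then have "norm (tail_ell2 m (T z)) \<le> e / 4 * 2"
      using e by (intro order_trans[OF m[OF z(1)]] mult_left_mono) auto
    finally have "norm (tail_ell2 m (T x)) \<le> e / 4 * 2 + e / 4"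
      using d(3) by simp
    then show "dist (T x) (head_ell2 m (T x)) < e"
      using e by (simp add: dist_norm tail_ell2_def[symmetric])
    have "norm (T x) \<le> c"
      using bound'[OF x(1)] mult_left_mono[OF x(2) less_imp_le[OF c(1)]] by simp
    then show "head_ell2 m (T x) \<in> K"
      unfolding head_ell2_eq_sum by (intro K order_trans[OF norm_ell2_nth_le])
  qed
  then show "\<exists>K. compact K \<and> (\<forall>x\<in>closure U. norm x \<le> 1 \<longrightarrow> (\<exists>y\<in>K. dist (T x) y < e))"
    using K(1) by blast
qed

end

section \<open>Operators from the Hilbert space\<close>

context bd_system
begin

text \<open>
  Bounded operators out of the Hilbert space map tails to vectors with small initial coordinates, which
  makes it possible to replace their images by blocks.
\<close>

lemma coordinates_small_on_tail:
  fixes T :: "'k ell2 \<Rightarrow> 'k linf"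
  assumes add: "\<And>x y. T (x + y) = T x + T y"
    and scale: "\<And>c x. T (scale_ell2 c x) = scale_linf c (T x)"
    and bound: "\<And>x. norm (T x) \<le> C * norm x"
    and e: "0 < e"
  shows "\<exists>m\<ge>m0. \<forall>i<N. \<forall>x. norm (T (tail_ell2 m x) i) \<le> e * norm x"
proof -
  have "\<forall>\<^sub>F m in sequentially. \<forall>x. norm (T (tail_ell2 m x) i) \<le> e * norm x" for i
    unfolding eventually_sequentially
    by (rule ell2_functional_tail[of "\<lambda>x. T x i" C])
       (auto simp: add scale scale_linf_apply e intro: order_trans[OF norm_bounded bound])
  then have "\<forall>\<^sub>F m in sequentially. \<forall>i\<in>{..<N}. \<forall>x. norm (T (tail_ell2 m x) i) \<le> e * norm x"
    by (intro eventually_ball_finite) auto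
  then have "\<forall>\<^sub>F m in sequentially. (\<forall>i\<in>{..<N}. \<forall>x. norm (T (tail_ell2 m x) i) \<le> e * norm x) \<and> m0 \<le> m"
    using eventually_ge_at_top by (rule eventually_conj)
  then show ?thesis
    unfolding eventually_sequentially by auto
qed

context
  fixes T :: "'k ell2 \<Rightarrow> 'k linf" and C :: real
  assumes T_add: "\<And>x y. T (x + y) = T x + T y"
    and T_scale: "\<And>c x. T (scale_ell2 c x) = scale_linf c (T x)"
    and T_bound: "\<And>x. norm (T x) \<le> C * norm x"
    and T_closure: "\<And>x. T x \<in> closure U"
begin

text \<open>
  A finite vector \<open>u\<close> that shows \<open>T\<close> to be large: for small \<open>s\<close> and \<open>\<eta>\<close> it contradicts boundedness. The
  image \<open>T u\<close> is only close to the block \<open>x\<close>, but blocks can be combined without error, so stating the lower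
  bound \<open>\<delta>\<close> for \<open>x\<close> keeps it from deteriorating when witnesses are combined. The parameters \<open>m\<close> and \<open>n\<close>
  allow the next witness to start where the previous one, at \<open>m'\<close> and \<open>n'\<close>, ends.
\<close>

definition witness :: "real \<Rightarrow> real \<Rightarrow> nat \<Rightarrow> nat \<Rightarrow> real \<Rightarrow> nat \<Rightarrow> nat \<Rightarrow> nat
    \<Rightarrow> 'k ell2 \<Rightarrow> 'k linf \<Rightarrow> bool" where
  "witness \<delta> s m n \<eta> m' n' g u x \<longleftrightarrow>
     m \<le> m' \<and> (\<forall>i. i < m \<or> m' \<le> i \<longrightarrow> ell2_nth u i = 0) \<and> (norm u)\<^sup>2 \<le> s \<and>
     n \<le> n' \<and> x \<in> F n' \<and> (\<forall>i<d n. x i = 0) \<and> g < d n' \<and> \<delta> \<le> norm (x g) \<and>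
     norm (T u - x) \<le> \<eta>"

lemma T_minus: "T (x - y) = T x - T y"
proof -
  have "x - y = x + scale_ell2 (-1) y"
    by (rule ell2_eqI) simp
  then show ?thesis
    by (simp only: T_add T_scale diff_eq_scale[of "T x"])
qed

lemma witness_base:
  assumes e: "0 < e" and bad: "\<And>m. \<exists>u. e * norm u < norm (T (tail_ell2 m u))"
    and \<eta>: "0 < \<eta>"
  shows "\<exists>m' n' g u x. witness (e / 2) 1 m n \<eta> m' n' g u x"
proof -
  define \<eta>' where "\<eta>' = min \<eta> (e / 2) / (1 + 2 * lam)"
  have \<eta>': "0 < \<eta>'" "(1 + 2 * lam) * \<eta>' \<le> \<eta>" "(1 + 2 * lam) * \<eta>' \<le> e / 2"
    using e \<eta> lam_gt_1 by (simp_all add: \<eta>'_def)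
  obtain m0 where m0: "m \<le> m0" "\<And>i x. i < d n \<Longrightarrow> norm (T (tail_ell2 m0 x) i) \<le> \<eta>' * norm x"
    using coordinates_small_on_tail[OF T_add T_scale T_bound \<eta>'(1)] by blast
  obtain u0 where u0: "e * norm u0 < norm (T (tail_ell2 m0 u0))"
    using bad by blast
  have T0: "T 0 = 0" using T_add[of 0 0] by simp
  have tail0: "tail_ell2 m0 0 = (0 :: 'k ell2)" by (rule ell2_eqI) simp
  have nz: "0 < norm u0"
    using u0 T0 tail0 by (cases "u0 = 0") auto
  define u1 where "u1 = tail_ell2 m0 (scale_ell2 (of_real (1 / norm u0)) u0)"
  have u0_eq: "T (tail_ell2 m0 u0) = scale_linf (of_real (norm u0)) (T u1)"
    using nz unfolding u1_def tail_ell2_scale T_scale[symmetric]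
    by (intro arg_cong[of _ _ T] ell2_eqI) (simp flip: mult.assoc of_real_mult)
  have "norm u0 * e < norm u0 * norm (T u1)"
    using u0 norm_scale_linf[of "of_real (norm u0)" "T u1"] unfolding u0_eq
    by (simp add: mult.commute)
  then have u1: "e < norm (T u1)" using nz by simp
  have "norm u1 \<le> norm (scale_ell2 (of_real (1 / norm u0)) u0)"
    unfolding u1_def by (rule norm_tail_ell2_le)
  then have nu1: "norm u1 \<le> 1"
    using nz by (simp add: norm_scale_ell2 norm_divide)
  let ?C = "\<bar>C\<bar> + 1"
  obtain m' where m': "m0 \<le> m'" "norm (tail_ell2 m' u1) < (norm (T u1) - e) / ?C"
    using norm_tail_ell2_small[of "(norm (T u1) - e) / ?C" m0 u1] u1 by auto
  define u where "u = head_ell2 m' u1"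
  have u_tail: "u = tail_ell2 m0 u"
    by (rule ell2_eqI) (simp add: u_def u1_def)
  have nu: "norm u \<le> 1"
    using nu1 norm_head_ell2_le[of m' u1] unfolding u_def by linarith
  have "norm (T u1 - T u) \<le> C * norm (tail_ell2 m' u1)"
    unfolding T_minus[symmetric] u_def tail_ell2_def by (rule T_bound)
  also have "\<dots> \<le> ?C * norm (tail_ell2 m' u1)"
    by (intro mult_right_mono) auto
  also have "\<dots> < norm (T u1) - e"
    using m'(2) by (simp add: pos_less_divide_eq mult.commute)
  finally have Tu: "e < norm (T u)"
    using norm_triangle_ineq2[of "T u1" "T u"] by linarith
  obtain z where z: "z \<in> U" "dist z (T u) < \<eta>'"
    using T_closure[of u] \<eta>'(1) closure_approachable by blast
  obtain n1 where n1: "n \<le> n1" "z \<in> F n1" using z(1) by (rule U_E)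
  \<comment> \<open>The first \<open>d n\<close> entries of \<open>z\<close> are of size \<open>2 \<eta>'\<close>, so cutting them off costs \<open>2 \<lambda> \<eta>'\<close>; this explains
      the factor \<open>1 + 2 \<lambda>\<close> in the choice of \<open>\<eta>'\<close>.\<close>
  define x where "x = z - proj n z"
  have "norm (z i) \<le> 2 * \<eta>'" if "i < d n" for i
  proof -
    have "norm (T u i) \<le> \<eta>'"
      using m0(2)[OF that, of u] mult_left_mono[OF nu less_imp_le[OF \<eta>'(1)]] u_tail[symmetric] by simp
    moreover have "norm (z i - T u i) \<le> \<eta>'"
      using z(2) norm_bounded[of "z - T u" i] by (simp add: dist_norm)
    ultimately show ?thesis
      using norm_triangle_ineq2[of "z i" "T u i"] by linarith
  qed
  then have "norm (proj n z) \<le> lam * (2 * \<eta>')"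
    using \<eta>'(1) by (intro norm_proj_le) auto
  then have "norm (T u - x) \<le> \<eta>' + lam * (2 * \<eta>')"
    using z(2) norm_triangle_ineq[of "T u - z" "proj n z"]
    by (simp add: x_def dist_norm norm_minus_commute algebra_simps)
  then have Tu_x: "norm (T u - x) \<le> (1 + 2 * lam) * \<eta>'"
    by (simp add: algebra_simps)
  have "e / 2 < norm x"
    using Tu_x \<eta>'(3) Tu norm_triangle_ineq2[of "T u" x] by linarith
  then obtain g where g: "e / 2 < norm (x g)"
    using norm_bound[of x "e / 2"] by (meson not_le)
  define n' where "n' = max n1 (Suc g)"
  have "x \<in> F n'"
    using n1 F_mono[of n n'] F_mono[of n1 n'] proj_mem[of n z]
    unfolding x_def by (intro F_diff) (auto simp: n'_def le_max_iff_disj)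
  moreover have "g < d n'"
    using d_unbounded[of g] d_mono[of "Suc g" n'] by (simp add: n'_def)
  moreover have "x i = 0" if "i < d n" for i
    using that by (simp add: x_def E_extends)
  moreover have "ell2_nth u i = 0" if "i < m \<or> m' \<le> i" for i
    using that m0(1) by (auto simp: u_def u1_def)
  moreover have "m \<le> m'"
    using m0(1) m'(1) by simp
  moreover have "(norm u)\<^sup>2 \<le> 1"
    using nu by (simp add: power_le_one)
  moreover have "norm (T u - x) \<le> \<eta>"
    using Tu_x \<eta>'(2) by linarith
  ultimately have "witness (e / 2) 1 m n \<eta> m' n' g u x"
    unfolding witness_def using g n1 by (auto simp: n'_def)
  then show ?thesis by blast
qed

text \<open>
  Rotating the witness makes its value at \<open>g\<close> a nonnegative real, so that two such values cannot cancel.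
\<close>

lemma witness_unimodular:
  assumes "witness \<delta> s m n \<eta> m' n' g u x"
  shows "\<exists>u x r. witness \<delta> s m n \<eta> m' n' g u x \<and> x g = of_real r \<and> \<delta> \<le> r"
proof -
  obtain \<theta> where \<theta>: "norm \<theta> = 1" "\<theta> * x g = of_real (norm (x g))"
    using unimodular_real by blast
  have "T (scale_ell2 \<theta> u) - scale_linf \<theta> x = scale_linf \<theta> (T u - x)"
    by (rule bcontfun_eqI) (simp add: T_scale scale_linf_apply right_diff_distrib)
  then have "norm (T (scale_ell2 \<theta> u) - scale_linf \<theta> x) \<le> norm (T u - x)"
    using norm_scale_linf[of \<theta> "T u - x"] \<theta> by simp
  then have "witness \<delta> s m n \<eta> m' n' g (scale_ell2 \<theta> u) (scale_linf \<theta> x)"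
    using assms \<theta> unfolding witness_def
    by (auto simp: norm_scale_ell2 scale_linf_apply norm_mult F_scale)
  then show ?thesis
    using \<theta> assms
    by (intro exI[of _ "scale_ell2 \<theta> u"] exI[of _ "scale_linf \<theta> x"] exI[of _ "norm (x g)"])
       (simp add: witness_def scale_linf_apply)
qed

text \<open>
  The step that uses the lower estimate in the space. For a block \<open>x\<^sub>1\<close> followed by a block \<open>x\<^sub>2\<close>, the
  coordinate given by \<open>(n\<^sub>1, g\<^sub>1, g\<^sub>2)\<close> takes the value \<open>a x g\<^sub>1 + b (x - P x) g\<^sub>2\<close> at
  \<open>x = a\<^sup>2 x\<^sub>1 + b\<^sup>2 x\<^sub>2\<close>, which is \<open>a\<^sup>3 x\<^sub>1 g\<^sub>1 + b\<^sup>3 x\<^sub>2 g\<^sub>2\<close>. Since \<open>a\<^sup>3 + b\<^sup>3 = 1\<close>, the lower bound \<open>\<delta>\<close> is preserved,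
  whereas the squared norm of \<open>a\<^sup>2 u\<^sub>1 + b\<^sup>2 u\<^sub>2\<close> shrinks by the factor \<open>a\<^sup>4 + b\<^sup>4 < 1\<close>.
\<close>

lemma witness_step:
  assumes left: "witness \<delta> s m n (\<eta> / 2) m1 n1 g1 u1 x1"
    and right: "witness \<delta> s m1 n1 (\<eta> / 2) m2 n2 g2 u2 x2"
  shows "\<exists>m' n' g u x. witness \<delta> ((a ^ 4 + b ^ 4) * s) m n \<eta> m' n' g u x"
proof -
  from witness_unimodular[OF left] obtain u1 x1 r1 where
    L: "witness \<delta> s m n (\<eta> / 2) m1 n1 g1 u1 x1" "x1 g1 = of_real r1" "\<delta> \<le> r1" by blast
  from witness_unimodular[OF right] obtain u2 x2 r2 where
    R: "witness \<delta> s m1 n1 (\<eta> / 2) m2 n2 g2 u2 x2" "x2 g2 = of_real r2" "\<delta> \<le> r2" by blast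
  have ab: "0 < a" "0 < b" using b_pos b_less_a by auto
  let ?a = "of_real (a\<^sup>2) :: 'k" and ?b = "of_real (b\<^sup>2) :: 'k"
  define u where "u = scale_ell2 ?a u1 + scale_ell2 ?b u2"
  define x where "x = scale_linf ?a x1 + scale_linf ?b x2"
  \<comment> \<open>The projection inside a coordinate of level \<open>N\<close> has strictly lower index; the successor ensures \<open>n1 < N\<close>.\<close>
  define N where "N = Suc n2"
  have nn: "n \<le> n1" "n1 < N" "n1 \<le> N" "n2 \<le> N"
    using L(1) R(1) by (auto simp: witness_def N_def)
  have g: "g1 < d n1" "g2 < d N"
    using L(1) R(1) d_mono[OF nn(4)] by (auto simp: witness_def)
  have x1: "x1 \<in> F n1" "x1 \<in> F N" and x2: "x2 \<in> F N" "\<And>i. i < d n1 \<Longrightarrow> x2 i = 0"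
    using L(1) R(1) F_mono[OF nn(3)] F_mono[OF nn(4)] by (auto simp: witness_def)
  have xN: "x \<in> F N"
    using x1 x2 by (simp add: x_def F_add F_scale)
  obtain k where k: "k < d (Suc N)"
    "\<And>u. E N u k = of_real a * u g1 + of_real b * (u g2 - E n1 u g2)"
    using coordinate_exists[OF nn(2) g] by blast
  have "proj n1 x = scale_linf ?a x1"
    using x1(1) proj_eq_0[OF x2(2)]
    by (intro bcontfun_eqI) (simp add: x_def proj_add proj_scale mem_F_iff scale_linf_apply del: proj_apply)
  then have "x g2 - proj n1 x g2 = ?b * of_real r2"
    by (simp add: x_def scale_linf_apply R(2) del: proj_apply)
  moreover have "x k = of_real a * x g1 + of_real b * (x g2 - proj n1 x g2)"
    using k(2)[of x] xN unfolding mem_F_iff proj_apply[symmetric] by simp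
  moreover have "x g1 = ?a * of_real r1"
    using x2(2)[OF g(1)] by (simp add: x_def scale_linf_apply L(2))
  ultimately have xk: "x k = of_real (a ^ 3 * r1 + b ^ 3 * r2)"
    by (simp add: power2_eq_square power3_eq_cube mult.assoc)
  have "(a ^ 3 + b ^ 3) * \<delta> \<le> a ^ 3 * r1 + b ^ 3 * r2"
    unfolding distrib_right using L(3) R(3) ab by (intro add_mono mult_left_mono) auto
  then have "\<delta> \<le> norm (x k)"
    unfolding xk norm_of_real using cubes by simp
  moreover have "(norm u)\<^sup>2 \<le> (a ^ 4 + b ^ 4) * s"
  proof -
    have "(norm u)\<^sup>2 = (norm (scale_ell2 ?a u1))\<^sup>2 + (norm (scale_ell2 ?b u2))\<^sup>2"
      unfolding u_def
    proof (rule norm_ell2_add_disjoint_sq)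
      show "ell2_nth (scale_ell2 ?a u1) i = 0 \<or> ell2_nth (scale_ell2 ?b u2) i = 0" for i
        using L(1) R(1) by (cases "i < m1") (simp_all add: witness_def)
    qed
    also have "\<dots> = a ^ 4 * (norm u1)\<^sup>2 + b ^ 4 * (norm u2)\<^sup>2"
      by (simp add: norm_scale_ell2 norm_power power_mult_distrib flip: power_mult)
    also have "\<dots> \<le> a ^ 4 * s + b ^ 4 * s"
      using L(1) R(1) by (intro add_mono mult_left_mono) (auto simp: witness_def)
    finally show ?thesis by (simp add: distrib_right)
  qed
  moreover have "norm (T u - x) \<le> \<eta>"
  proof -
    have "a\<^sup>2 \<le> 1" "b\<^sup>2 \<le> 1"
      using ab a_less_1 b_less_a by (simp_all add: power_le_one)
    then have ab1: "norm ?a \<le> 1" "norm ?b \<le> 1"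
      by (simp_all add: norm_power del: of_real_power)
    have "T u - x = scale_linf ?a (T u1 - x1) + scale_linf ?b (T u2 - x2)"
      by (rule bcontfun_eqI)
         (simp add: u_def x_def T_add T_scale scale_linf_apply right_diff_distrib)
    then have "norm (T u - x) \<le> norm (scale_linf ?a (T u1 - x1)) + norm (scale_linf ?b (T u2 - x2))"
      by (simp only: norm_triangle_ineq)
    also have "\<dots> \<le> norm ?a * norm (T u1 - x1) + norm ?b * norm (T u2 - x2)"
      by (intro add_mono norm_scale_linf)
    also have "\<dots> \<le> 1 * (\<eta> / 2) + 1 * (\<eta> / 2)"
      using L(1) R(1) by (intro add_mono mult_mono ab1) (simp_all add: witness_def)
    finally have "norm (T u - x) \<le> 1 * (\<eta> / 2) + 1 * (\<eta> / 2)" .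
    then show ?thesis by simp
  qed
  moreover have "m \<le> m1" "m1 \<le> m2"
    using L(1) R(1) by (auto simp: witness_def)
  moreover from this have "ell2_nth u i = 0" if "i < m \<or> m2 \<le> i" for i
    using that L(1) R(1) by (auto simp: witness_def u_def)
  moreover have "x i = 0" if "i < d n" for i
    using that L(1) x2(2)[of i] d_mono[OF nn(1)] by (simp add: x_def scale_linf_apply witness_def)
  ultimately have "witness \<delta> ((a ^ 4 + b ^ 4) * s) m n \<eta> m2 (Suc N) k u x"
    unfolding witness_def using nn k(1) xN F_mono[of N "Suc N"] by auto
  then show ?thesis by blast
qed

lemma witness_exists:
  assumes e: "0 < e" and bad: "\<And>m. \<exists>u. e * norm u < norm (T (tail_ell2 m u))"
  shows "0 < \<eta> \<Longrightarrow> \<exists>m' n' g u x. witness (e / 2) ((a ^ 4 + b ^ 4) ^ D) m n \<eta> m' n' g u x"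
proof (induction D arbitrary: m n \<eta>)
  case 0
  then show ?case using witness_base[OF e bad] by simp
next
  case (Suc D)
  then have h: "0 < \<eta> / 2" by simp
  obtain m1 n1 g1 u1 x1 where
    1: "witness (e / 2) ((a ^ 4 + b ^ 4) ^ D) m n (\<eta> / 2) m1 n1 g1 u1 x1"
    using Suc.IH[OF h, of m n] by (elim exE)
  obtain m2 n2 g2 u2 x2 where
    2: "witness (e / 2) ((a ^ 4 + b ^ 4) ^ D) m1 n1 (\<eta> / 2) m2 n2 g2 u2 x2"
    using Suc.IH[OF h, of m1 n1] by (elim exE)
  show ?case
    unfolding power_Suc by (rule witness_step[OF 1 2])
qed

text \<open>
  After \<open>D\<close> steps \<open>norm (T u)\<close> is still at least \<open>e / 4\<close>, but \<open>(norm u)\<^sup>2 \<le> (a\<^sup>4 + b\<^sup>4) ^ D\<close>.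
\<close>

lemma image_of_tail_small:
  assumes e: "0 < e"
  shows "\<exists>m. \<forall>u. norm (T (tail_ell2 m u)) \<le> e * norm u"
proof (rule ccontr)
  assume "\<not> ?thesis"
  then have bad: "\<exists>u. e * norm u < norm (T (tail_ell2 m u))" for m
    by (meson not_le)
  let ?s = "a ^ 4 + b ^ 4"
  have s: "0 < ?s" "?s < 1"
    using fourth_powers b_pos b_less_a by (auto intro: add_pos_pos)
  have C: "0 < C\<^sup>2 + 1" by (simp add: add_nonneg_pos)
  obtain D where D: "?s ^ D < (e / 4)\<^sup>2 / (C\<^sup>2 + 1)"
    using real_arch_pow_inv[of "(e / 4)\<^sup>2 / (C\<^sup>2 + 1)" ?s] e s C by auto
  obtain m' n' g u x where w: "witness (e / 2) (?s ^ D) 0 0 (e / 4) m' n' g u x"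
    using witness_exists[OF e bad, of "e / 4" D 0 0] e by auto
  have "e / 2 \<le> norm x" "norm (T u - x) \<le> e / 4"
    using w norm_bounded[of x g] by (auto simp: witness_def)
  then have "e / 4 \<le> norm (T u)"
    using norm_triangle_ineq3[of "T u" x] by linarith
  also have "\<dots> \<le> C * norm u" by (rule T_bound)
  finally have "(e / 4)\<^sup>2 \<le> (C * norm u)\<^sup>2"
    using e by (intro power_mono) auto
  also have "\<dots> \<le> (C\<^sup>2 + 1) * ?s ^ D"
    unfolding power_mult_distrib using w by (intro mult_mono) (auto simp: witness_def)
  also have "\<dots> < (e / 4)\<^sup>2"
    using D C by (simp add: pos_less_divide_eq mult.commute)
  finally show False by simp
qed

end

lemma operator_from_ell2_compact:
  fixes T :: "'k ell2 \<Rightarrow> 'k linf"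
  assumes "bounded_operator scale_ell2 scale_linf UNIV (closure U) T"
  shows "compact_operator UNIV (closure U) T"
proof (rule compact_operatorI)
  show "complete (closure U)"
    by (rule complete_closed_subset[OF _ _ complete_linf]) simp_all
  obtain C where mem: "\<And>x. T x \<in> closure U"
    and add: "\<And>x y. T (x + y) = T x + T y"
    and scale: "\<And>c x. T (scale_ell2 c x) = scale_linf c (T x)"
    and bound: "\<And>x. norm (T x) \<le> C * norm x"
    using assms unfolding bounded_operator_def by auto
  have T0: "T 0 = 0" using add[of 0 0] by simp
  have T_sum: "T (\<Sum>i\<in>A. f i) = (\<Sum>i\<in>A. T (f i))" for f and A :: "nat set"
    by (induction A rule: infinite_finite_induct) (simp_all add: T0 add)
  fix e :: real assume e: "0 < e"
  then obtain m where m: "\<And>u. norm (T (tail_ell2 m u)) \<le> e / 2 * norm u"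
    using image_of_tail_small[OF add scale bound mem, of "e / 2"] by auto
  obtain K where K: "compact K"
    "\<And>c. (\<And>i. norm (c i) \<le> 1) \<Longrightarrow> (\<Sum>i<m. scale_linf (c i) (T (unit_ell2 i))) \<in> K"
    using compact_linear_combinations[of "scale_linf :: 'k \<Rightarrow> _" 1 "\<lambda>i. T (unit_ell2 i)" m]
    by (auto simp: norm_scale_linf scale_linf_diff)
  have "\<exists>y\<in>K. dist (T u) y < e" if u: "norm u \<le> 1" for u
  proof
    have "T (head_ell2 m u) = (\<Sum>i<m. scale_linf (ell2_nth u i) (T (unit_ell2 i)))"
      by (simp add: head_ell2_eq_sum T_sum scale)
    then show "T (head_ell2 m u) \<in> K"
      using u by (simp add: K(2) order_trans[OF norm_ell2_nth_le])
    have "T u = T (head_ell2 m u) + T (tail_ell2 m u)"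
      unfolding add[symmetric] by (simp add: tail_ell2_def)
    then have "dist (T u) (T (head_ell2 m u)) \<le> e / 2 * norm u"
      using m[of u] by (simp add: dist_norm)
    also have "\<dots> \<le> e / 2 * 1"
      using u e by (intro mult_left_mono) auto
    finally show "dist (T u) (T (head_ell2 m u)) < e"
      using e by simp
  qed
  then show "\<exists>K. compact K \<and> (\<forall>u\<in>UNIV. norm u \<le> 1 \<longrightarrow> (\<exists>y\<in>K. dist (T u) y < e))"
    using K(1) by blast
qed

end

section \<open>Compactness of all operators\<close>

lemma bd_operators_compact:
  fixes a b lam :: real and d :: "nat \<Rightarrow> nat"
    and inc :: "nat \<Rightarrow> nat \<Rightarrow> (nat \<Rightarrow> 'k) \<Rightarrow> nat \<Rightarrow> 'k::{real_normed_field,heine_borel}"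
  assumes "0 < b" "b < a" "a < 1" "a ^ 3 + b ^ 3 = 1" "1 < lam" "a + 2 * b * lam \<le> lam"
    and bd: "bd_construction a b d inc"
  shows "bounded_operator scale_ell2 scale_linf UNIV (bd_space d inc) T
      \<Longrightarrow> compact_operator UNIV (bd_space d inc) T"
    and "bounded_operator scale_linf scale_ell2 (bd_space d inc) UNIV T'
      \<Longrightarrow> compact_operator (bd_space d inc) UNIV T'"
proof -
  interpret bd_system a b lam d "\<lambda>n u. bd_embedding inc n (coord_proj (d n) u)"
    using bd assms by (intro bd_system_extension)
  have "bd_subspace d inc n = F n" for n
  proof (intro equalityI subsetI)
    fix f assume "f \<in> bd_subspace d inc n"
    then obtain u where "u \<in> coord_space (d n)" "apply_bcontfun f = bd_embedding inc n u"
      by (auto simp: bd_subspace_def)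
    then have "f = embed n u"
      by (intro bcontfun_eqI) (simp add: coord_proj_id[OF bd])
    then show "f \<in> F n" by (simp add: F_def)
  next
    fix f assume "f \<in> F n"
    then show "f \<in> bd_subspace d inc n"
      by (auto simp: F_def bd_subspace_def intro!: imageI coord_proj_mem[OF bd])
  qed
  then have X: "bd_space d inc = closure U"
    by (simp add: bd_space_def U_def)
  show "bounded_operator scale_ell2 scale_linf UNIV (bd_space d inc) T
      \<Longrightarrow> compact_operator UNIV (bd_space d inc) T"
    unfolding X by (rule operator_from_ell2_compact)
  show "bounded_operator scale_linf scale_ell2 (bd_space d inc) UNIV T'
      \<Longrightarrow> compact_operator (bd_space d inc) UNIV T'"
    unfolding X by (rule operator_to_ell2_compact)
qed

theorem theorem3p2:
  fixes a b :: real
  assumes "0 < b" and "b < a" and "a < 1" and "a + b > 1" and "a ^ 3 + b ^ 3 = 1"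
    and "\<exists>lam::real. lam > 1 \<and> a + 2 * b * lam \<le> lam"
  shows "(\<forall>d (inc :: nat \<Rightarrow> nat \<Rightarrow> (nat \<Rightarrow> real) \<Rightarrow> nat \<Rightarrow> real). bd_construction a b d inc \<longrightarrow>
           (\<forall>T. bounded_operator scale_ell2 scale_linf UNIV (bd_space d inc) T
              \<longrightarrow> compact_operator UNIV (bd_space d inc) T) \<and>
           (\<forall>T. bounded_operator scale_linf scale_ell2 (bd_space d inc) UNIV T
              \<longrightarrow> compact_operator (bd_space d inc) UNIV T)) \<and>
         (\<forall>d (inc :: nat \<Rightarrow> nat \<Rightarrow> (nat \<Rightarrow> complex) \<Rightarrow> nat \<Rightarrow> complex). bd_construction a b d inc \<longrightarrow>
           (\<forall>T. bounded_operator scale_ell2 scale_linf UNIV (bd_space d inc) T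
              \<longrightarrow> compact_operator UNIV (bd_space d inc) T) \<and>
           (\<forall>T. bounded_operator scale_linf scale_ell2 (bd_space d inc) UNIV T
              \<longrightarrow> compact_operator (bd_space d inc) UNIV T))"
proof -
  obtain lam where "1 < lam" "a + 2 * b * lam \<le> lam"
    using assms by blast
  then show ?thesis
    using assms by (intro conjI allI impI bd_operators_compact[where lam = lam])
qed

end
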